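(* For every positive integer $n$ and every integral lattice $\mathcal{L} \subset \mathbb{R}^n$, $N_{\leq 2}(\mathcal{L}) \leq f(n) + 1$, where \[ f(n) := \begin{cases} 126 & n = 7\\ 240 + 2(n-8)^2 & 8 \leq n \leq 11 \\ 2n^2 & \text{otherwise.}\end{cases} \] Moreover, this bound is tight for all $n$: for every positive integer $n$ there is an integral lattice $\mathcal{L} \subset \mathbb{R}^n$ with $N_{\leq 2}(\mathcal{L}) = f(n) + 1$.
   Context: A lattice $\mathcal{L} \subset \mathbb{R}^n$ is the set of integer linear combinations of some linearly independent vectors in $\mathbb{R}^n$. It is called integral if $\langle \boldsymbol{y}_1, \boldsymbol{y}_2\rangle \in \mathbb{Z}$ for all $\boldsymbol{y}_1, \boldsymbol{y}_2 \in \mathcal{L}$, where $\langle\cdot,\cdot\rangle$ is the standard inner product. With $\|\cdot\|$ the Euclidean norm, $N_{\leq 2}(\mathcal{L}) := |\{\boldsymbol{y} \in \mathcal{L} : \|\boldsymbol{y}\|^2 \leq 2\}|$. *)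

theory Defs
  imports "HOL-Analysis.Analysis"
begin

text \<open>Lattices need not have full rank: the generating set is any linearly independent set,
  the empty one (which gives the zero lattice) included. Linearly independent sets in
  \<open>real ^ 'n\<close> are finite, so the sum below is a genuine one.\<close>

definition is_lattice :: "(real ^ 'n) set \<Rightarrow> bool" where
  "is_lattice L \<longleftrightarrow>
     (\<exists>B. independent B \<and> L = {y. \<exists>c :: real ^ 'n \<Rightarrow> int. y = (\<Sum>b\<in>B. of_int (c b) *\<^sub>R b)})"

definition integral_lattice :: "(real ^ 'n) set \<Rightarrow> bool" where
  "integral_lattice L \<longleftrightarrow> is_lattice L \<and> (\<forall>x\<in>L. \<forall>y\<in>L. x \<bullet> y \<in> \<int>)"

definition N_le2 :: "(real ^ 'n) set \<Rightarrow> nat" where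
  "N_le2 L = card {y \<in> L. (norm y)\<^sup>2 \<le> 2}"

definition f_bound :: "nat \<Rightarrow> nat" where
  "f_bound n = (if n = 7 then 126
          else if 8 \<le> n \<and> n \<le> 11 then 240 + 2 * (n - 8)\<^sup>2
          else 2 * n\<^sup>2)"

text \<open>\<^const>\<open>card\<close> is 0 on infinite sets; the next lemma shows that this convention never
  plays a role in \<^const>\<open>N_le2\<close> for integral lattices.\<close>

lemma finite_N_le2:
  fixes L :: "(real ^ 'n) set"
  assumes "integral_lattice L"
  shows "finite {y \<in> L. (norm y)\<^sup>2 \<le> 2}"
proof -
  from assms obtain B where B: "independent B"
    and L: "L = {y. \<exists>c :: real ^ 'n \<Rightarrow> int. y = (\<Sum>b\<in>B. of_int (c b) *\<^sub>R b)}"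
    unfolding integral_lattice_def is_lattice_def by blast
  have int: "x \<bullet> y \<in> \<int>" if "x \<in> L" "y \<in> L" for x y
    using assms that unfolding integral_lattice_def by blast
  have fin: "finite B"
    using B independent_imp_finite by blast
  have BL: "b \<in> L" if "b \<in> B" for b
  proof -
    have "(\<Sum>a\<in>B. of_int (if a = b then 1 else 0) *\<^sub>R a) = (\<Sum>a\<in>B. if a = b then a else 0)"
      by (intro sum.cong) auto
    also have "\<dots> = b"
      using that fin by simp
    finally show ?thesis
      unfolding L mem_Collect_eq by (intro exI[of _ "\<lambda>a. if a = b then 1 else 0"]) simp
  qed
  have span: "y \<in> span B" if "y \<in> L" for y
    using that unfolding L by (auto intro: span_sum span_scale span_base)
  define S where "S = {y \<in> L. (norm y)\<^sup>2 \<le> 2}"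
  define g :: "real ^ 'n \<Rightarrow> real ^ 'n \<Rightarrow> real" where "g = (\<lambda>y. restrict (\<lambda>b. y \<bullet> b) B)"
  have "inj_on g S"
  proof (rule inj_onI)
    fix x y assume xy: "x \<in> S" "y \<in> S" "g x = g y"
    have "x \<bullet> b = y \<bullet> b" if "b \<in> B" for b
      using fun_cong[OF xy(3), of b] that by (simp add: g_def)
    then have "orthogonal (x - y) b" if "b \<in> B" for b
      using that by (simp add: orthogonal_def inner_diff_left)
    moreover have "x - y \<in> span B"
      using xy span by (auto simp: S_def intro: span_diff)
    ultimately have "orthogonal (x - y) (x - y)"
      using orthogonal_to_span by blast
    then show "x = y"
      by (simp add: orthogonal_def)
  qed
  moreover have "finite (g ` S)"
  proof (rule finite_subset)
    show "g ` S \<subseteq> (\<Pi>\<^sub>E b\<in>B. {t \<in> \<int>. \<bar>t\<bar> \<le> 2 * norm b})"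
    proof
      fix h assume "h \<in> g ` S"
      then obtain y where y: "y \<in> S" "h = g y" by blast
      have "(norm y)\<^sup>2 \<le> 2\<^sup>2"
        using y(1) by (simp add: S_def)
      then have "norm y \<le> 2"
        by (rule power2_le_imp_le) simp
      then have "\<bar>y \<bullet> b\<bar> \<le> 2 * norm b" for b
        by (meson Cauchy_Schwarz_ineq2 mult_right_mono norm_ge_zero order_trans)
      then show "h \<in> (\<Pi>\<^sub>E b\<in>B. {t \<in> \<int>. \<bar>t\<bar> \<le> 2 * norm b})"
        using y int BL by (auto simp: g_def S_def)
    qed
    have "finite {t \<in> \<int>. \<bar>t\<bar> \<le> (r::real)}" for r
      using finite_abs_int_segment by blast
    then show "finite (\<Pi>\<^sub>E b\<in>B. {t \<in> (\<int>::real set). \<bar>t\<bar> \<le> 2 * norm b})"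
      using fin by (intro finite_PiE) auto
  qed
  ultimately show ?thesis
    unfolding S_def by (rule finite_imageD[rotated])
qed

end

theory Submission
  imports Defs
begin

text \<open>Throughout, the norm of \<open>x\<close> means \<open>x \<bullet> x\<close>. The vectors counted are \<open>0\<close>, the unit vectors
  and the vectors of norm \<open>2\<close>, here called roots.
  Integrality makes unit vectors equal, opposite or orthogonal and makes each of them split off as an
  orthogonal summand, so \<open>2 * m\<close> unit vectors account for \<open>2 * m\<^sup>2\<close> vectors of norm at most \<open>2\<close> and
  the remaining ones are roots in a space of dimension \<open>n - m\<close> (\<open>card_units_roots_le\<close>). What is left
  is a bound on the number of roots in dimension \<open>k\<close>. Instead of the classification of root systems,
  the proof uses one inequality: for vectors in a \<open>k\<close>-dimensional space, the square of the sum of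
  their norms is at most \<open>k\<close> times the sum of all squared inner products (\<open>trace_inequality\<close>).

  Call \<open>a\<close> a neighbour of the root \<open>b\<close> if \<open>a\<close> is a root with \<open>a \<bullet> b = 1\<close>. Applied to all roots, the
  inequality bounds their number by \<open>k * (4 + m) / 2\<close> when no root has more than \<open>m\<close> neighbours
  (\<open>card_roots_le\<close>). Applied to the projections of the neighbours of \<open>b\<close> to the hyperplane orthogonal to
  \<open>b\<close>, it bounds \<open>m\<close> itself (\<open>card_neighbours_relative_bound\<close>). The two bounds together settle
  \<open>k \<le> 8\<close>, with the values \<open>126\<close> and \<open>240\<close> for \<open>k = 7\<close> and \<open>k = 8\<close>.

  For \<open>k \<ge> 9\<close> a root with more than \<open>4 * k - 4\<close> neighbours forces a copy of \<open>E8\<close>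
  (\<open>card_neighbours_le_or_has_E8\<close>). Indeed such a root lies in a \<open>D4\<close>, and its neighbours outside that
  \<open>D4\<close> fall into three families that triality permutes. The components
  orthogonal to the \<open>D4\<close> are unit vectors, and those that belong to one family are equal, opposite or
  orthogonal. If one family alone is present, this limits its size; if two are present, either all
  three are tiny or the \<open>D4\<close> grows to a \<open>D8\<close> together with a half-integral root, which is \<open>E8\<close>. As
  \<open>E8\<close> is unimodular, every root outside it is orthogonal to it, and induction applies to the
  complement. If there is no such root, then \<open>m \<le> 4 * k - 4\<close> and there are at most \<open>2 * k\<^sup>2\<close> roots.

  The bound is attained by the cubic lattice, by \<open>E8\<close> plus a cubic lattice for \<open>8 \<le> n \<le> 11\<close>, and by
  \<open>E7\<close> for \<open>n = 7\<close>. The last two are given by congruences on coordinates; that these define lattices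
  follows because a subgroup of a lattice is a lattice (\<open>subgroup_of_int_span\<close>).\<close>

section \<open>The trace inequality\<close>

text \<open>In an orthonormal basis \<open>B\<close> of \<open>U\<close>, let \<open>M b c\<close> be the sum of \<open>(v a \<bullet> b) * (v a \<bullet> c)\<close> over
  the family. The left-hand side is the square of the trace of \<open>M\<close> and the double sum is the squared
  Frobenius norm of \<open>M\<close>; the inequality is Cauchy--Schwarz on the diagonal of \<open>M\<close>.\<close>

lemma trace_inequality:
  fixes v :: "'i \<Rightarrow> 'a::euclidean_space"
  assumes U: "subspace U" and A: "finite A" "v ` A \<subseteq> U"
  shows "(\<Sum>a\<in>A. v a \<bullet> v a)\<^sup>2 \<le> real (dim U) * (\<Sum>a\<in>A. \<Sum>a'\<in>A. (v a \<bullet> v a')\<^sup>2)"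
proof -
  obtain B where B: "pairwise orthogonal B" "\<And>x. x \<in> B \<Longrightarrow> norm x = 1"
    "independent B" "card B = dim U" "span B = U"
    using orthonormal_basis_subspace[OF U] by metis
  have finB: "finite B"
    using B(3) independent_imp_finite by blast
  define M where "M b c = (\<Sum>a\<in>A. (v a \<bullet> b) * (v a \<bullet> c))" for b c
  have expand: "v a \<bullet> v a' = (\<Sum>b\<in>B. (v a \<bullet> b) * (v a' \<bullet> b))" if "a \<in> A" "a' \<in> A" for a a'
  proof -
    have "v a' = (\<Sum>b\<in>B. (v a' \<bullet> b) *\<^sub>R b)"
      using orthonormal_basis_expand[OF B(1,2), of "v a'"] A(2) B(5) finB that by auto
    then have "v a \<bullet> v a' = v a \<bullet> (\<Sum>b\<in>B. (v a' \<bullet> b) *\<^sub>R b)"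
      by simp
    also have "\<dots> = (\<Sum>b\<in>B. (v a \<bullet> b) * (v a' \<bullet> b))"
      by (simp add: inner_sum_right mult.commute)
    finally show ?thesis .
  qed
  have "(\<Sum>a\<in>A. v a \<bullet> v a) = (\<Sum>a\<in>A. \<Sum>b\<in>B. (v a \<bullet> b) * (v a \<bullet> b))"
    by (intro sum.cong refl expand)
  also have "\<dots> = (\<Sum>b\<in>B. M b b)"
    unfolding M_def by (rule sum.swap)
  finally have trace: "(\<Sum>a\<in>A. v a \<bullet> v a) = (\<Sum>b\<in>B. M b b)" .
  have "(\<Sum>a\<in>A. \<Sum>a'\<in>A. (v a \<bullet> v a')\<^sup>2)
      = (\<Sum>a\<in>A. \<Sum>a'\<in>A. \<Sum>b\<in>B. \<Sum>c\<in>B. ((v a \<bullet> b) * (v a \<bullet> c)) * ((v a' \<bullet> b) * (v a' \<bullet> c)))"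
    by (intro sum.cong refl) (simp add: expand power2_eq_square sum_product mult_ac)
  also have "\<dots> = (\<Sum>b\<in>B. \<Sum>a\<in>A. \<Sum>a'\<in>A. \<Sum>c\<in>B. ((v a \<bullet> b) * (v a \<bullet> c)) * ((v a' \<bullet> b) * (v a' \<bullet> c)))"
    by (subst sum.swap[of _ B A]) (intro sum.cong refl sum.swap)
  also have "\<dots> = (\<Sum>b\<in>B. \<Sum>c\<in>B. \<Sum>a\<in>A. \<Sum>a'\<in>A. ((v a \<bullet> b) * (v a \<bullet> c)) * ((v a' \<bullet> b) * (v a' \<bullet> c)))"
    by (rule sum.cong[OF refl], subst sum.swap[of _ B A]) (intro sum.cong refl sum.swap)
  also have "\<dots> = (\<Sum>b\<in>B. \<Sum>c\<in>B. (M b c)\<^sup>2)"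
    by (simp add: M_def power2_eq_square sum_product)
  finally have frob: "(\<Sum>a\<in>A. \<Sum>a'\<in>A. (v a \<bullet> v a')\<^sup>2) = (\<Sum>b\<in>B. \<Sum>c\<in>B. (M b c)\<^sup>2)" .
  have "(\<Sum>b\<in>B. M b b)\<^sup>2 \<le> (\<Sum>b\<in>B. (M b b)\<^sup>2) * card B"
    by (rule sum_squared_le_sum_of_squares)
  also have "\<dots> \<le> (\<Sum>b\<in>B. \<Sum>c\<in>B. (M b c)\<^sup>2) * card B"
    by (intro mult_right_mono sum_mono member_le_sum finB) auto
  finally show ?thesis
    unfolding trace frob B(4) by (simp add: mult.commute)
qed

lemma dim_orthogonal_complement_in:
  fixes U :: "'a::euclidean_space set"
  assumes "subspace U" "F \<subseteq> U" "independent F"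
  shows "subspace {x\<in>U. \<forall>e\<in>F. x \<bullet> e = 0}"
    and "dim {x\<in>U. \<forall>e\<in>F. x \<bullet> e = 0} + card F = dim U"
proof -
  show "subspace {x\<in>U. \<forall>e\<in>F. x \<bullet> e = 0}"
    using assms(1) by (auto simp: subspace_def inner_add_left)
  have "(\<forall>e\<in>F. x \<bullet> e = 0) \<longleftrightarrow> (\<forall>y\<in>span F. orthogonal y x)" for x
    by (metis orthogonal_commute orthogonal_def orthogonal_to_span span_base)
  then have "{x\<in>U. \<forall>e\<in>F. x \<bullet> e = 0} = {x\<in>U. \<forall>y\<in>span F. orthogonal y x}"
    by simp
  moreover have "dim (span F) = card F"
    using assms(3) by (simp add: dim_eq_card_independent)
  moreover have "span F \<subseteq> U"
    using assms by (simp add: span_minimal)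
  ultimately show "dim {x\<in>U. \<forall>e\<in>F. x \<bullet> e = 0} + card F = dim U"
    using dim_subspace_orthogonal_to_vectors[of "span F" U] assms(1) by simp
qed

section \<open>Roots of an integral group\<close>

definition add_group :: "'a::real_vector set \<Rightarrow> bool" where
  "add_group H \<longleftrightarrow> 0 \<in> H \<and> (\<forall>x\<in>H. \<forall>y\<in>H. x - y \<in> H)"

lemma add_groupD:
  assumes "add_group H"
  shows "0 \<in> H" "\<And>x y. x \<in> H \<Longrightarrow> y \<in> H \<Longrightarrow> x - y \<in> H" "\<And>x. x \<in> H \<Longrightarrow> - x \<in> H"
    "\<And>x y. x \<in> H \<Longrightarrow> y \<in> H \<Longrightarrow> x + y \<in> H"
proof -
  show neg: "- x \<in> H" if "x \<in> H" for x
    using assms that unfolding add_group_def by (metis diff_0)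
  show "x + y \<in> H" if "x \<in> H" "y \<in> H" for x y
    using assms that neg[of y] unfolding add_group_def by (metis diff_minus_eq_add)
qed (use assms in \<open>auto simp: add_group_def\<close>)

lemma add_group_scaleR:
  assumes "add_group H" "x \<in> H"
  shows "of_int c *\<^sub>R x \<in> H"
proof (induction c rule: int_induct[where k = 0])
  case base
  then show ?case
    using add_groupD(1)[OF assms(1)] by simp
next
  case (step1 i)
  then show ?case
    using add_groupD(4)[OF assms(1) _ assms(2)] by (simp add: scaleR_left_distrib)
next
  case (step2 i)
  then show ?case
    using add_groupD(2)[OF assms(1) _ assms(2)] by (simp add: scaleR_left_diff_distrib)
qed

definition integral_group :: "'a::euclidean_space set \<Rightarrow> bool" where
  "integral_group L \<longleftrightarrow> add_group L \<and> (\<forall>x\<in>L. \<forall>y\<in>L. x \<bullet> y \<in> \<int>)"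

definition roots :: "'a::euclidean_space set \<Rightarrow> 'a set" where
  "roots L = {x\<in>L. x \<bullet> x = 2}"

definition neighbours :: "'a::euclidean_space set \<Rightarrow> 'a \<Rightarrow> 'a set" where
  "neighbours L b = {a\<in>roots L. a \<bullet> b = 1}"

lemma integral_groupD:
  assumes "integral_group L"
  shows "0 \<in> L" "\<And>x y. x \<in> L \<Longrightarrow> y \<in> L \<Longrightarrow> x + y \<in> L" "\<And>x y. x \<in> L \<Longrightarrow> y \<in> L \<Longrightarrow> x - y \<in> L"
    "\<And>x y. x \<in> L \<Longrightarrow> y \<in> L \<Longrightarrow> x \<bullet> y \<in> \<int>" "\<And>x. x \<in> L \<Longrightarrow> - x \<in> L"
    "\<And>x c. x \<in> L \<Longrightarrow> of_int c *\<^sub>R x \<in> L"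
proof -
  have G: "add_group L"
    using assms by (simp add: integral_group_def)
  show "0 \<in> L" "\<And>x y. x \<in> L \<Longrightarrow> y \<in> L \<Longrightarrow> x + y \<in> L" "\<And>x y. x \<in> L \<Longrightarrow> y \<in> L \<Longrightarrow> x - y \<in> L"
    "\<And>x. x \<in> L \<Longrightarrow> - x \<in> L" "\<And>x c. x \<in> L \<Longrightarrow> of_int c *\<^sub>R x \<in> L"
    by (fact add_groupD[OF G] add_group_scaleR[OF G])+
  show "\<And>x y. x \<in> L \<Longrightarrow> y \<in> L \<Longrightarrow> x \<bullet> y \<in> \<int>"
    using assms by (simp add: integral_group_def)
qed

lemma integral_group_restrict:
  assumes "integral_group L" "subspace U"
  shows "integral_group (L \<inter> U)"
  using assms by (auto simp: integral_group_def add_group_def subspace_0 subspace_diff)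

lemma Ints_abs_le_2_cases:
  fixes t :: real
  assumes "t \<in> \<int>" "\<bar>t\<bar> \<le> 2"
  shows "t = -2 \<or> t = -1 \<or> t = 0 \<or> t = 1 \<or> t = 2"
proof -
  obtain n :: int where "t = of_int n"
    using assms(1) Ints_cases by blast
  with assms(2) have "n \<le> 2" "-2 \<le> n"
    by linarith+
  then have "n = -2 \<or> n = -1 \<or> n = 0 \<or> n = 1 \<or> n = 2"
    by presburger
  with \<open>t = of_int n\<close> show ?thesis
    by auto
qed

lemma root_inner_cases:
  assumes "integral_group L" "a \<in> roots L" "b \<in> roots L"
  shows "a \<bullet> b = 2 \<and> a = b \<or> a \<bullet> b = -2 \<and> a = - b \<or> a \<bullet> b \<in> {-1, 0, 1}"
proof -
  have ab: "a \<bullet> a = 2" "b \<bullet> b = 2" "a \<bullet> b \<in> \<int>"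
    using assms integral_groupD(4) by (auto simp: roots_def)
  have "\<bar>a \<bullet> b\<bar> \<le> norm a * norm b"
    by (rule Cauchy_Schwarz_ineq2)
  also have "\<dots> = 2"
    using ab(1,2) by (simp add: norm_eq_sqrt_inner)
  finally have "\<bar>a \<bullet> b\<bar> \<le> 2" .
  moreover have "a = b" if "a \<bullet> b = 2"
  proof -
    have "(a - b) \<bullet> (a - b) = 0"
      using ab that by (simp add: inner_diff_left inner_diff_right inner_commute)
    then show ?thesis by simp
  qed
  moreover have "a = - b" if "a \<bullet> b = -2"
  proof -
    have "(a + b) \<bullet> (a + b) = 0"
      using ab that by (simp add: inner_add_left inner_add_right inner_commute)
    then show ?thesis
      using eq_neg_iff_add_eq_0 by auto
  qed
  ultimately show ?thesis
    using Ints_abs_le_2_cases[OF ab(3)] by auto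
qed

text \<open>Only \<open>b\<close> and \<open>- b\<close> have inner product \<open>\<plusminus>2\<close> with \<open>b\<close>, and negation matches the roots with
  inner product \<open>-1\<close> with the neighbours.\<close>

lemma sum_inner_squared_roots:
  assumes L: "integral_group L" "finite (roots L)" and b: "b \<in> roots L"
  shows "(\<Sum>a\<in>roots L. (a \<bullet> b)\<^sup>2) = 8 + 2 * real (card (neighbours L b))"
proof -
  define Z where "Z = {a\<in>roots L. a \<bullet> b = 0}"
  let ?N = "neighbours L b"
  have bb: "b \<bullet> b = 2" "- b \<in> roots L"
    using b integral_groupD(5)[OF L(1)] by (auto simp: roots_def)
  have neg: "uminus ` ?N = {a\<in>roots L. a \<bullet> b = -1}"
  proof
    show "{a\<in>roots L. a \<bullet> b = -1} \<subseteq> uminus ` ?N"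
    proof
      fix a assume "a \<in> {a\<in>roots L. a \<bullet> b = -1}"
      then have "- a \<in> ?N"
        using integral_groupD(5)[OF L(1)] by (auto simp: neighbours_def roots_def)
      then show "a \<in> uminus ` ?N"
        by (metis imageI minus_minus)
    qed
  qed (use integral_groupD(5)[OF L(1)] in \<open>auto simp: neighbours_def roots_def\<close>)
  have split: "roots L = ({b, - b} \<union> (?N \<union> uminus ` ?N)) \<union> Z"
    using root_inner_cases[OF L(1) _ b] b bb(2)
    unfolding neg by (auto simp: neighbours_def Z_def)
  have fin: "finite ?N" "finite Z"
    using L(2) by (auto simp: neighbours_def Z_def)
  have bneg: "b \<noteq> - b"
  proof
    assume "b = - b"
    then have "b \<bullet> b = - (b \<bullet> b)"
      by (metis inner_minus_left)
    then show False
      using bb(1) by simp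
  qed
  have disj: "?N \<inter> uminus ` ?N = {}" "{b, - b} \<inter> (?N \<union> uminus ` ?N) = {}"
    "({b, - b} \<union> (?N \<union> uminus ` ?N)) \<inter> Z = {}" "b \<noteq> - b"
    unfolding neg using bb bneg by (auto simp: neighbours_def Z_def)
  have "(\<Sum>a\<in>roots L. (a \<bullet> b)\<^sup>2) = (\<Sum>a\<in>{b, - b}. (a \<bullet> b)\<^sup>2)
      + ((\<Sum>a\<in>?N. (a \<bullet> b)\<^sup>2) + (\<Sum>a\<in>uminus ` ?N. (a \<bullet> b)\<^sup>2)) + (\<Sum>a\<in>Z. (a \<bullet> b)\<^sup>2)"
    by (subst split) (simp add: sum.union_disjoint disj fin del: Un_insert_left)
  also have "(\<Sum>a\<in>{b, - b}. (a \<bullet> b)\<^sup>2) = 8"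
    using disj(4) bb by simp
  also have "(\<Sum>a\<in>?N. (a \<bullet> b)\<^sup>2) = real (card ?N)"
    by (simp add: neighbours_def)
  also have "(\<Sum>a\<in>uminus ` ?N. (a \<bullet> b)\<^sup>2) = real (card ?N)"
    by (subst sum.reindex) (auto simp: neighbours_def)
  also have "(\<Sum>a\<in>Z. (a \<bullet> b)\<^sup>2) = 0"
    by (simp add: Z_def)
  finally show ?thesis
    by simp
qed

text \<open>The trace inequality for the family of all roots. For an irreducible root system that spans
  \<open>U\<close>, every root has the same number \<open>m\<close> of neighbours, the Coxeter number is \<open>(4 + m) / 2\<close>, and
  equality holds: the number of roots is the rank times the Coxeter number.\<close>

lemma card_roots_le:
  assumes L: "integral_group L" "finite (roots L)" "L \<subseteq> U" "subspace U"
    and m: "\<And>b. b \<in> roots L \<Longrightarrow> card (neighbours L b) \<le> m"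
  shows "2 * card (roots L) \<le> dim U * (4 + m)"
proof (cases "roots L = {}")
  case False
  let ?R = "roots L" and ?N = "real (card (roots L))"
  have pos: "?N > 0"
    using False L(2) by (simp add: card_gt_0_iff)
  have "(\<Sum>a\<in>?R. a \<bullet> a)\<^sup>2 \<le> real (dim U) * (\<Sum>b\<in>?R. \<Sum>a\<in>?R. (b \<bullet> a)\<^sup>2)"
    using trace_inequality[OF L(4,2), of "\<lambda>x. x"] L(3) by (auto simp: roots_def)
  also have "(\<Sum>a\<in>?R. a \<bullet> a) = 2 * ?N"
    by (simp add: roots_def)
  also have "(\<Sum>b\<in>?R. \<Sum>a\<in>?R. (b \<bullet> a)\<^sup>2) = (\<Sum>b\<in>?R. 8 + 2 * real (card (neighbours L b)))"
    using sum_inner_squared_roots[OF L(1,2)] by (intro sum.cong) (auto simp: inner_commute)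
  also have "\<dots> \<le> (\<Sum>b\<in>?R. 8 + 2 * real m)"
    using m by (intro sum_mono) simp
  finally have "(2 * ?N)\<^sup>2 \<le> real (dim U) * (?N * (8 + 2 * real m))"
    by (simp add: mult_left_mono)
  then have "?N * (2 * ?N) \<le> ?N * (real (dim U) * (4 + real m))"
    by (simp add: power2_eq_square algebra_simps)
  then have "2 * ?N \<le> real (dim U) * (4 + real m)"
    using pos by (rule mult_left_le_imp_le)
  then show ?thesis
    by (metis (mono_tags) of_nat_add of_nat_le_iff of_nat_mult of_nat_numeral)
qed simp

lemma finite_neighbours: "finite (roots L) \<Longrightarrow> finite (neighbours L b)"
  by (simp add: neighbours_def)

lemma neighbours_reflect:
  assumes L: "integral_group L" and b: "b \<in> roots L" and a: "a \<in> neighbours L b"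
  shows "b - a \<in> neighbours L b"
  using a b integral_groupD(3)[OF L]
  by (auto simp: neighbours_def roots_def inner_diff_left inner_diff_right inner_commute)

lemma neighbours_inner_cases:
  assumes L: "integral_group L" and b: "b \<in> roots L"
    and a: "a \<in> neighbours L b" "a' \<in> neighbours L b"
  shows "a = a' \<or> a' = b - a \<or> a \<bullet> a' = 0 \<or> a \<bullet> a' = 1"
proof -
  have r: "a \<in> roots L" "a' \<in> roots L" "b - a \<in> roots L"
    using a neighbours_reflect[OF L b a(1)] by (auto simp: neighbours_def)
  have sum: "(b - a) \<bullet> a' = 1 - a \<bullet> a'"
    using a(2) by (simp add: neighbours_def inner_diff_left inner_commute[of b])
  show ?thesis
    using root_inner_cases[OF L r(1,2)] root_inner_cases[OF L r(3,2)] sum by auto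
qed

text \<open>Projecting the neighbours of \<open>b\<close> to the hyperplane orthogonal to \<open>b\<close> gives vectors that
  span equiangular lines with angle \<open>arccos (1/3)\<close>. The trace inequality for these vectors is the
  relative bound for equiangular lines.\<close>

lemma card_neighbours_relative_bound:
  assumes L: "integral_group L" "finite (roots L)" "L \<subseteq> U" "subspace U"
    and b: "b \<in> roots L"
  shows "9 * card (neighbours L b) \<le> (dim U - 1) * (card (neighbours L b) + 16)"
proof (cases "neighbours L b = {}")
  case False
  let ?A = "neighbours L b" and ?m = "real (card (neighbours L b))"
  define v where "v a = a - (1/2) *\<^sub>R b" for a
  define V where "V = {x\<in>U. \<forall>e\<in>{b}. x \<bullet> e = 0}"
  have bb: "b \<bullet> b = 2" "b \<in> U"
    using b L(3) by (auto simp: roots_def)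
  have fin: "finite ?A"
    using L(2) by (rule finite_neighbours)
  then have pos: "?m > 0"
    using False by (simp add: card_gt_0_iff)
  have "independent {b}"
    using bb(1) by auto
  then have V: "subspace V" "dim V + 1 = dim U"
    using dim_orthogonal_complement_in[OF L(4), of "{b}"] bb(2) by (auto simp: V_def)
  have inner: "v a \<bullet> v a' = a \<bullet> a' - 1/2" if "a \<in> ?A" "a' \<in> ?A" for a a'
    using that bb(1)
    by (simp add: v_def neighbours_def inner_diff_left inner_diff_right inner_commute)
  have "v a \<in> V" if "a \<in> ?A" for a
    using that L(3,4) bb
    by (auto simp: V_def v_def neighbours_def roots_def subspace_diff subspace_scale inner_diff_left)
  then have "v ` ?A \<subseteq> V"
    by auto
  then have trace: "(\<Sum>a\<in>?A. v a \<bullet> v a)\<^sup>2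
      \<le> real (dim V) * (\<Sum>a\<in>?A. \<Sum>a'\<in>?A. (v a \<bullet> v a')\<^sup>2)"
    using trace_inequality V(1) fin by blast
  have norms: "(\<Sum>a\<in>?A. v a \<bullet> v a) = (\<Sum>a\<in>?A. 3/2)"
    by (intro sum.cong refl) (simp add: inner, simp add: neighbours_def roots_def)
  have "(\<Sum>a\<in>?A. \<Sum>a'\<in>?A. (v a \<bullet> v a')\<^sup>2) \<le> (\<Sum>a\<in>?A. ?m / 4 + 4)"
  proof (rule sum_mono)
    fix a assume a: "a \<in> ?A"
    have "(\<Sum>a'\<in>?A. (v a \<bullet> v a')\<^sup>2)
        \<le> (\<Sum>a'\<in>?A. 1/4 + (if a' = a then 2 else 0) + (if a' = b - a then 2 else 0))"
    proof (rule sum_mono)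
      fix a' assume a': "a' \<in> ?A"
      have "a \<bullet> a = 2" "a \<bullet> b = 1"
        using a by (auto simp: neighbours_def roots_def)
      then show "(v a \<bullet> v a')\<^sup>2 \<le> 1/4 + (if a' = a then 2 else 0) + (if a' = b - a then 2 else 0)"
        using neighbours_inner_cases[OF L(1) b a a'] inner[OF a a']
        by (auto simp: power2_eq_square inner_diff_right)
    qed
    also have "\<dots> = ?m / 4 + 4"
      using fin a neighbours_reflect[OF L(1) b a] by (simp add: sum.distrib)
    finally show "(\<Sum>a'\<in>?A. (v a \<bullet> v a')\<^sup>2) \<le> ?m / 4 + 4" .
  qed
  then have "(\<Sum>a\<in>?A. 3/2)\<^sup>2 \<le> real (dim V) * (\<Sum>a\<in>?A. ?m / 4 + 4)"
    using trace unfolding norms by (meson mult_left_mono of_nat_0_le_iff order_trans)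
  then have "?m * (9 * ?m) \<le> ?m * (real (dim V) * (?m + 16))"
    by (simp add: power2_eq_square algebra_simps)
  then have "9 * ?m \<le> real (dim V) * (?m + 16)"
    using pos by (rule mult_left_le_imp_le)
  then have "9 * card ?A \<le> dim V * (card ?A + 16)"
    by (metis (mono_tags) of_nat_add of_nat_le_iff of_nat_mult of_nat_numeral)
  moreover have "dim V = dim U - 1"
    using V(2) by simp
  ultimately show ?thesis
    by simp
qed simp

text \<open>In dimensions \<open>1\<close> to \<open>8\<close> the relative bound limits the number \<open>m\<close> of neighbours to
  \<open>0, 2, 4, 8, 12, 20, 32, 56\<close>, and \<open>dim U * (4 + m) / 2\<close> is then at most \<^const>\<open>f_bound\<close>. In
  dimensions \<open>7\<close> and \<open>8\<close> these are the numbers \<open>126\<close> and \<open>240\<close> of the roots of \<open>E7\<close> and \<open>E8\<close>.\<close>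

lemma card_roots_le_f_bound_small:
  assumes L: "integral_group L" "finite (roots L)" "L \<subseteq> U" "subspace U" and k: "dim U \<le> 8"
  shows "card (roots L) \<le> f_bound (dim U)"
proof -
  define m where "m = Max (insert 0 ((\<lambda>b. card (neighbours L b)) ` roots L))"
  have fin: "finite (insert 0 ((\<lambda>b. card (neighbours L b)) ` roots L))"
    using L(2) by simp
  have le: "card (neighbours L b) \<le> m" if "b \<in> roots L" for b
    unfolding m_def using fin that by (intro Max_ge) auto
  have "m \<in> insert 0 ((\<lambda>b. card (neighbours L b)) ` roots L)"
    unfolding m_def using fin by (intro Max_in) auto
  then have m: "9 * m \<le> (dim U - 1) * (m + 16)"
    using card_neighbours_relative_bound[OF L] by auto
  have N: "2 * card (roots L) \<le> dim U * (4 + m)"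
    by (rule card_roots_le[OF L le])
  have "card (roots L) \<le> f_bound k"
    if "k \<le> 8" "9 * m \<le> (k - 1) * (m + 16)" "2 * card (roots L) \<le> k * (4 + m)" for k
  proof -
    have "k \<in> {0, 1, 2, 3, 4, 5, 6, 7, 8}"
      using that(1) by auto
    then show ?thesis
      using that(2,3) by (elim insertE emptyE) (simp_all add: f_bound_def)
  qed
  then show ?thesis
    using k m N by blast
qed

section \<open>Orthonormal frames of type D\<close>

text \<open>The vectors \<open>\<plusminus>e \<plusminus> f\<close> with distinct \<open>e\<close> and \<open>f\<close> in \<open>F\<close> form a root system of type \<open>D\<close> in its
  standard coordinates. The frame vectors themselves need not belong to \<open>L\<close>.\<close>

definition D_frame :: "'a::euclidean_space set \<Rightarrow> 'a set \<Rightarrow> bool" where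
  "D_frame L F \<longleftrightarrow> finite F \<and> (\<forall>e\<in>F. e \<bullet> e = 1) \<and>
     (\<forall>e\<in>F. \<forall>f\<in>F. e \<noteq> f \<longrightarrow> e \<bullet> f = 0 \<and> e + f \<in> L \<and> e - f \<in> L)"

lemma integral_group_sum:
  assumes "integral_group L" "\<And>a. a \<in> A \<Longrightarrow> v a \<in> L"
  shows "sum v A \<in> L"
  using assms(2)
  by (induction A rule: infinite_finite_induct) (auto intro: integral_groupD[OF assms(1)])

lemma obtain_other_element:
  assumes "2 \<le> card F"
  obtains f where "f \<in> F" "f \<noteq> e"
proof -
  have "\<not> F \<subseteq> {e}"
  proof
    assume "F \<subseteq> {e}"
    then have "card F \<le> card {e}"
      by (intro card_mono) auto
    with assms show False by simp
  qed
  then show ?thesis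
    using that by blast
qed

lemma D_frame_double:
  assumes "integral_group L" "D_frame L F" "2 \<le> card F" "e \<in> F"
  shows "e + e \<in> L"
proof -
  obtain f where "f \<in> F" "f \<noteq> e"
    using obtain_other_element[OF assms(3)] by blast
  then have "(e + f) + (e - f) \<in> L"
    using assms integral_groupD(2) unfolding D_frame_def by metis
  then show ?thesis
    by simp
qed

lemma D_frame_subset:
  assumes "integral_group L" "D_frame L F" "2 \<le> card F" "L \<subseteq> U" "subspace U"
  shows "F \<subseteq> U"
proof
  fix e assume "e \<in> F"
  then have "e + e \<in> U"
    using D_frame_double assms by blast
  then have "(1/2) *\<^sub>R (e + e) \<in> U"
    using assms(5) subspace_scale by blast
  then show "e \<in> U"
    by simp
qed

lemma D_frame_independent:
  assumes "D_frame L F"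
  shows "independent F"
  using assms by (intro pairwise_orthogonal_independent)
    (auto simp: D_frame_def pairwise_def orthogonal_def)

text \<open>The differences \<open>e - e0\<close> and the vector \<open>2 *\<^sub>R e0\<close> lie in \<open>L\<close>, so replacing every \<open>e\<close> by \<open>e0\<close>
  changes the combination by an element of \<open>L\<close> and leaves an even multiple of \<open>e0\<close>.\<close>

lemma D_frame_combination:
  assumes L: "integral_group L" and F: "D_frame L F" "2 \<le> card F"
    and c: "even (\<Sum>e\<in>F. c e :: int)"
  shows "(\<Sum>e\<in>F. of_int (c e) *\<^sub>R e) \<in> L"
proof -
  obtain e0 where e0: "e0 \<in> F"
    using obtain_other_element[OF F(2)] by blast
  obtain d where d: "(\<Sum>e\<in>F. c e) = 2 * d"
    using c by blast
  have "e - e0 \<in> L" if "e \<in> F" for e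
    using F(1) e0 that integral_groupD(1)[OF L] by (cases "e = e0") (auto simp: D_frame_def)
  then have "(\<Sum>e\<in>F. of_int (c e) *\<^sub>R (e - e0)) \<in> L"
    by (intro integral_group_sum[OF L] integral_groupD(6)[OF L]) auto
  moreover have "of_int d *\<^sub>R (e0 + e0) \<in> L"
    by (intro integral_groupD(6)[OF L] D_frame_double[OF L F e0])
  ultimately have "(\<Sum>e\<in>F. of_int (c e) *\<^sub>R (e - e0)) + of_int d *\<^sub>R (e0 + e0) \<in> L"
    by (rule integral_groupD(2)[OF L])
  moreover have "(\<Sum>e\<in>F. of_int (c e) *\<^sub>R (e - e0))
      = (\<Sum>e\<in>F. of_int (c e) *\<^sub>R e) - of_int (\<Sum>e\<in>F. c e) *\<^sub>R e0"
    by (simp add: scaleR_right_diff_distrib sum_subtractf scaleR_sum_left)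
  moreover have "of_int d *\<^sub>R (e0 + e0) = of_int (2 * d) *\<^sub>R e0"
    by (simp add: scaleR_right_distrib flip: scaleR_left_distrib)
  ultimately show ?thesis
    by (simp add: d)
qed

text \<open>The inner products of \<open>x\<close> with \<open>e + f\<close> and \<open>e - f\<close> are integers, so twice each coordinate is an
  integer and any two coordinates differ by an integer.\<close>

lemma D_frame_coordinates:
  assumes L: "integral_group L" and F: "D_frame L F" "2 \<le> card F" and x: "x \<in> L"
  shows "(\<forall>e\<in>F. x \<bullet> e \<in> \<int>) \<or> (\<forall>e\<in>F. x \<bullet> e - 1/2 \<in> \<int>)"
proof -
  obtain e0 where e0: "e0 \<in> F"
    using obtain_other_element[OF F(2)] by blast
  have diff: "x \<bullet> e - x \<bullet> e0 \<in> \<int>" if "e \<in> F" for e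
    using F(1) e0 that x integral_groupD(4)[OF L, of x "e - e0"]
    by (cases "e = e0") (auto simp: D_frame_def inner_diff_right)
  have "x \<bullet> (e0 + e0) \<in> \<int>"
    using integral_groupD(4)[OF L x D_frame_double[OF L F e0]] .
  then obtain n :: int where n: "2 * (x \<bullet> e0) = of_int n"
    by (auto simp: inner_add_right elim: Ints_cases)
  show ?thesis
  proof (cases "even n")
    case True
    then have "x \<bullet> e0 \<in> \<int>"
      using n by (auto elim!: evenE)
    then have "x \<bullet> e \<in> \<int>" if "e \<in> F" for e
      using Ints_add[OF diff[OF that]] by fastforce
    then show ?thesis
      by blast
  next
    case False
    then obtain k where k: "n = 2 * k + 1"
      by (rule oddE)
    then have "x \<bullet> e0 - 1/2 = of_int k"
      using n by simp
    then have "x \<bullet> e0 - 1/2 \<in> \<int>"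
      by simp
    then have "x \<bullet> e - 1/2 \<in> \<int>" if "e \<in> F" for e
      using Ints_add[OF diff[OF that]] by fastforce
    then show ?thesis
      by blast
  qed
qed

lemma half_not_Ints: "(t::real) - 1/2 \<in> \<int> \<Longrightarrow> t \<notin> \<int>"
proof
  assume "t - 1/2 \<in> \<int>" "t \<in> \<int>"
  then obtain m n :: int where "t - 1/2 = of_int m" "t = of_int n"
    by (auto elim!: Ints_cases)
  then have "of_int (2 * (n - m)) = (of_int 1 :: real)"
    by simp
  then have "2 * (n - m) = 1"
    by (simp only: of_int_eq_iff)
  then show False
    by presburger
qed

lemma D_frame_all_half:
  assumes "integral_group L" "D_frame L F" "2 \<le> card F" "x \<in> L" "e \<in> F" "x \<bullet> e - 1/2 \<in> \<int>"
  shows "\<forall>e\<in>F. x \<bullet> e - 1/2 \<in> \<int>"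
  using D_frame_coordinates[OF assms(1-4)] half_not_Ints assms(5,6) by blast

lemma D_frame_all_int:
  assumes "integral_group L" "D_frame L F" "2 \<le> card F" "x \<in> L" "e \<in> F" "x \<bullet> e \<in> \<int>"
  shows "\<forall>e\<in>F. x \<bullet> e \<in> \<int>"
  using D_frame_coordinates[OF assms(1-4)] half_not_Ints assms(5,6) by blast

lemma half_square: "(t::real) = 1/2 \<or> t = -1/2 \<Longrightarrow> t\<^sup>2 = 1/4"
  by (erule disjE; hypsubst; simp add: power2_eq_square)

lemma half_int_square:
  fixes t :: real
  assumes "t - 1/2 \<in> \<int>"
  shows "t\<^sup>2 \<ge> 1/4" "t\<^sup>2 < 9/4 \<Longrightarrow> t = 1/2 \<or> t = -1/2"
proof -
  obtain n :: int where n: "t - 1/2 = of_int n"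
    using assms by (auto elim: Ints_cases)
  have "t = 1/2 \<or> t = -1/2 \<or> 3/2 \<le> \<bar>t\<bar>"
  proof -
    consider "n = 0" | "n = -1" | "n \<ge> 1" | "n \<le> -2"
      by linarith
    then show ?thesis
    proof cases
      case 3
      then have "1 \<le> (of_int n :: real)" by simp
      then show ?thesis using n by linarith
    next
      case 4
      then have "(of_int n :: real) \<le> -2" by simp
      then show ?thesis using n by linarith
    qed (use n in auto)
  qed
  moreover have "9/4 \<le> t\<^sup>2" if "3/2 \<le> \<bar>t\<bar>"
    using power_mono[OF that, of 2] by (simp add: power2_eq_square)
  ultimately show "t\<^sup>2 \<ge> 1/4" "t\<^sup>2 < 9/4 \<Longrightarrow> t = 1/2 \<or> t = -1/2"
    using half_square[of t] by linarith+
qed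

lemma int_square_ge_1:
  fixes t :: real
  assumes "t \<in> \<int>" "t \<noteq> 0"
  shows "t\<^sup>2 \<ge> 1"
proof -
  have "1 \<le> \<bar>t\<bar>"
    using assms by (rule Ints_nonzero_abs_ge1)
  then show ?thesis
    using abs_le_square_iff[of 1 t] by simp
qed

definition residual :: "'a::euclidean_space set \<Rightarrow> 'a \<Rightarrow> 'a" where
  "residual F x = x - (\<Sum>e\<in>F. (x \<bullet> e) *\<^sub>R e)"

lemma residual:
  assumes F: "D_frame L F"
  shows "e \<in> F \<Longrightarrow> residual F x \<bullet> e = 0"
    and "residual F x \<bullet> residual F x = x \<bullet> x - (\<Sum>e\<in>F. (x \<bullet> e)\<^sup>2)"
proof -
  have fin: "finite F"
    using F by (simp add: D_frame_def)
  have orth: "residual F x \<bullet> e = 0" if "e \<in> F" for e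
  proof -
    have "(\<Sum>f\<in>F. (x \<bullet> f) *\<^sub>R f) \<bullet> e = (\<Sum>f\<in>F. if f = e then x \<bullet> e else 0)"
      unfolding inner_sum_left using F that by (intro sum.cong) (auto simp: D_frame_def)
    then show ?thesis
      using fin that by (simp add: residual_def inner_diff_left)
  qed
  then show "e \<in> F \<Longrightarrow> residual F x \<bullet> e = 0" .
  have "residual F x \<bullet> residual F x = residual F x \<bullet> x - residual F x \<bullet> (\<Sum>e\<in>F. (x \<bullet> e) *\<^sub>R e)"
    by (subst (2) residual_def) (rule inner_diff_right)
  also have "residual F x \<bullet> (\<Sum>e\<in>F. (x \<bullet> e) *\<^sub>R e) = 0"
    by (simp add: inner_sum_right orth)
  also have "residual F x \<bullet> x - 0 = x \<bullet> x - (\<Sum>e\<in>F. (x \<bullet> e) * (e \<bullet> x))"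
    by (simp add: residual_def inner_diff_left inner_sum_left)
  also have "(\<Sum>e\<in>F. (x \<bullet> e) * (e \<bullet> x)) = (\<Sum>e\<in>F. (x \<bullet> e)\<^sup>2)"
    by (simp add: power2_eq_square inner_commute)
  finally show "residual F x \<bullet> residual F x = x \<bullet> x - (\<Sum>e\<in>F. (x \<bullet> e)\<^sup>2)" .
qed

lemma D_frame_bessel:
  assumes "D_frame L F"
  shows "(\<Sum>e\<in>F. (x \<bullet> e)\<^sup>2) \<le> x \<bullet> x"
    and "x \<bullet> x \<le> (\<Sum>e\<in>F. (x \<bullet> e)\<^sup>2) \<Longrightarrow> x = (\<Sum>e\<in>F. (x \<bullet> e) *\<^sub>R e)"
proof -
  show "(\<Sum>e\<in>F. (x \<bullet> e)\<^sup>2) \<le> x \<bullet> x"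
    using residual(2)[OF assms, of x] inner_ge_zero[of "residual F x"] by linarith
  assume "x \<bullet> x \<le> (\<Sum>e\<in>F. (x \<bullet> e)\<^sup>2)"
  then have "residual F x \<bullet> residual F x = 0"
    using residual(2)[OF assms, of x] inner_ge_zero[of "residual F x"] by linarith
  then show "x = (\<Sum>e\<in>F. (x \<bullet> e) *\<^sub>R e)"
    by (simp add: residual_def)
qed

text \<open>A single sum \<open>e + u\<close> in \<open>L\<close> suffices: all \<open>f + u\<close> and \<open>f - u\<close> differ from \<open>\<plusminus>(e + u)\<close> by elements
  that the old frame provides.\<close>

lemma D_frame_insert:
  assumes L: "integral_group L" and F: "D_frame L F" "2 \<le> card F" "e \<in> F"
    and u: "u \<bullet> u = 1" "\<And>f. f \<in> F \<Longrightarrow> u \<bullet> f = 0" "e + u \<in> L"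
  shows "D_frame L (insert u F)" "u \<notin> F"
proof -
  show "u \<notin> F"
    using u(1,2) by force
  have plus: "f + u \<in> L \<and> f - u \<in> L" if f: "f \<in> F" for f
  proof (cases "f = e")
    case True
    have "(e + e) - (e + u) \<in> L"
      using integral_groupD(3)[OF L D_frame_double[OF L F] u(3)] .
    then show ?thesis
      using True u(3) by simp
  next
    case False
    then have "e - f \<in> L" "e + f \<in> L"
      using F f by (auto simp: D_frame_def)
    then have "(e + u) - (e - f) \<in> L" "(e + f) - (e + u) \<in> L"
      using integral_groupD(3)[OF L] u(3) by blast+
    then show ?thesis
      by (simp add: algebra_simps)
  qed
  then have "u + f \<in> L \<and> u - f \<in> L" if "f \<in> F" for f
    using that integral_groupD(5)[OF L, of "f - u"] by (simp add: add.commute)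
  then show "D_frame L (insert u F)"
    using F(1) u(1,2) plus by (auto simp: D_frame_def inner_commute)
qed

section \<open>Splitting off E8\<close>

text \<open>This is the description of \<open>E8\<close> as \<open>D8\<close> extended by a half-spin weight: the root \<open>d\<close> has all
  eight coordinates equal to \<open>\<plusminus>1/2\<close>.\<close>

definition has_E8 :: "'a::euclidean_space set \<Rightarrow> bool" where
  "has_E8 L \<longleftrightarrow> (\<exists>F d. D_frame L F \<and> card F = 8 \<and> d \<in> roots L \<and> (\<forall>e\<in>F. d \<bullet> e - 1/2 \<in> \<int>))"

text \<open>A coordinate of absolute value at least \<open>3/2\<close> would contribute \<open>9/4 > 2\<close> to the norm.\<close>

lemma half_root_coordinates:
  assumes "D_frame L F" "d \<in> roots L" "\<forall>e\<in>F. d \<bullet> e - 1/2 \<in> \<int>" "e \<in> F"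
  shows "d \<bullet> e = 1/2 \<or> d \<bullet> e = -1/2"
proof -
  have "finite F"
    using assms(1) by (simp add: D_frame_def)
  then have "(d \<bullet> e)\<^sup>2 \<le> (\<Sum>g\<in>F. (d \<bullet> g)\<^sup>2)"
    using assms(4) by (intro member_le_sum) auto
  also have "\<dots> \<le> 2"
    using D_frame_bessel(1)[OF assms(1), of d] assms(2) by (simp add: roots_def)
  finally have "(d \<bullet> e)\<^sup>2 < 9/4"
    by simp
  then show ?thesis
    using half_int_square(2) assms(3,4) by blast
qed

text \<open>The component of \<open>d\<close> orthogonal to the frame has norm \<open>2 - 7/4 = 1/4\<close>, so its double \<open>u\<close> is a unit
  vector. With \<open>s e = 2 * (d \<bullet> e) = \<plusminus>1\<close>, the vector \<open>e0 + u\<close> is \<open>2 *\<^sub>R d\<close> minus the combination of the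
  frame with coefficients \<open>s e\<close>, lowered by \<open>1\<close> at \<open>e0\<close>; the coefficient sum is even because seven
  is odd. So \<open>u\<close> is an eighth frame vector.\<close>

lemma seven_frame_has_E8:
  assumes L: "integral_group L" and F: "D_frame L F" "card F = 7"
    and d: "d \<in> roots L" "\<forall>e\<in>F. d \<bullet> e - 1/2 \<in> \<int>"
  shows "has_E8 L"
proof -
  have c2: "2 \<le> card F"
    using F(2) by simp
  have fin: "finite F"
    using F(1) by (simp add: D_frame_def)
  have half: "d \<bullet> e = 1/2 \<or> d \<bullet> e = -1/2" if "e \<in> F" for e
    by (rule half_root_coordinates[OF F(1) d that])
  obtain e0 where e0: "e0 \<in> F"
    using obtain_other_element[OF c2] by blast
  define u where "u = 2 *\<^sub>R residual F d"
  have "(\<Sum>e\<in>F. (d \<bullet> e)\<^sup>2) = (\<Sum>e\<in>F. 1/4)"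
    by (intro sum.cong refl half_square half)
  then have uu: "u \<bullet> u = 1"
    using residual(2)[OF F(1), of d] d(1) F(2) by (simp add: u_def roots_def)
  have uF: "u \<bullet> f = 0" if "f \<in> F" for f
    using residual(1)[OF F(1) that] by (simp add: u_def)
  define c :: "'a \<Rightarrow> int" where
    "c e = (if d \<bullet> e = 1/2 then 1 else -1) - (if e = e0 then 1 else 0)" for e
  have c_half: "of_int (c e) = 2 * (d \<bullet> e) - (if e = e0 then 1 else 0)" if "e \<in> F" for e
    using half[OF that] by (auto simp: c_def)
  have "{e\<in>F. odd (c e)} = F - {e0}"
    by (auto simp: c_def)
  then have "even (\<Sum>e\<in>F. c e)"
    using fin e0 F(2) by (simp add: even_sum_iff)
  then have "(\<Sum>e\<in>F. of_int (c e) *\<^sub>R e) \<in> L"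
    by (rule D_frame_combination[OF L F(1) c2])
  moreover have "d + d \<in> L"
    using d(1) integral_groupD(2)[OF L] by (simp add: roots_def)
  ultimately have "d + d - (\<Sum>e\<in>F. of_int (c e) *\<^sub>R e) \<in> L"
    by (rule integral_groupD(3)[OF L, rotated])
  also have "(\<Sum>e\<in>F. of_int (c e) *\<^sub>R e)
      = (\<Sum>e\<in>F. (2 * (d \<bullet> e)) *\<^sub>R e - (if e = e0 then e0 else 0))"
    by (intro sum.cong refl) (simp add: c_half scaleR_left_diff_distrib)
  also have "\<dots> = 2 *\<^sub>R (\<Sum>e\<in>F. (d \<bullet> e) *\<^sub>R e) - e0"
    using fin e0 by (simp add: sum_subtractf scaleR_sum_right)
  also have "d + d - (2 *\<^sub>R (\<Sum>e\<in>F. (d \<bullet> e) *\<^sub>R e) - e0) = e0 + u"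
    by (simp add: u_def residual_def scaleR_2 algebra_simps)
  finally have "e0 + u \<in> L" .
  then have F': "D_frame L (insert u F)" "u \<notin> F"
    using D_frame_insert[OF L F(1) c2 e0 uu uF] by blast+
  moreover have "card (insert u F) = 8"
    using F'(2) F(2) fin by simp
  moreover have "\<forall>e\<in>insert u F. d \<bullet> e - 1/2 \<in> \<int>"
    using D_frame_all_half[OF L F'(1), of d e0] d e0 F(2) F'(2) fin by (simp add: roots_def)
  ultimately show ?thesis
    unfolding has_E8_def using d(1) by blast
qed

text \<open>\<open>E8\<close> is unimodular, so it is an orthogonal summand. Concretely, half-integral coordinates of \<open>x\<close>
  have squares of sum at least \<open>8/4 = 2\<close>, which is the whole norm of \<open>x\<close>. For integral coordinates
  \<open>n e\<close>, integrality of \<open>x \<bullet> d\<close> makes the sum of the \<open>n e\<close> even, hence also the sum of their squares;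
  that sum is at most \<open>2\<close>, so it is \<open>0\<close> or \<open>2\<close>.\<close>

lemma E8_frame_splits:
  assumes L: "integral_group L" and F: "D_frame L F" "card F = 8"
    and d: "d \<in> roots L" "\<forall>e\<in>F. d \<bullet> e - 1/2 \<in> \<int>" and x: "x \<in> roots L"
  shows "x \<in> span F \<or> (\<forall>e\<in>F. x \<bullet> e = 0)"
proof -
  have c2: "2 \<le> card F"
    using F(2) by simp
  have fin: "finite F"
    using F(1) by (simp add: D_frame_def)
  have dL: "d \<in> L" "d \<bullet> d = 2" and xL: "x \<in> L" "x \<bullet> x = 2"
    using d(1) x by (auto simp: roots_def)
  have span: "x \<in> span F" if "(\<Sum>e\<in>F. (x \<bullet> e)\<^sup>2) \<ge> 2"
  proof -
    have "x = (\<Sum>e\<in>F. (x \<bullet> e) *\<^sub>R e)"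
      by (rule D_frame_bessel(2)[OF F(1)]) (simp add: that xL(2))
    also have "\<dots> \<in> span F"
      by (intro span_sum span_scale span_base)
    finally show ?thesis .
  qed
  consider "\<forall>e\<in>F. x \<bullet> e - 1/2 \<in> \<int>" | "\<forall>e\<in>F. x \<bullet> e \<in> \<int>"
    using D_frame_coordinates[OF L F(1) c2 xL(1)] by blast
  then show ?thesis
  proof cases
    case 1
    have "(\<Sum>e\<in>F. 1/4) \<le> (\<Sum>e\<in>F. (x \<bullet> e)\<^sup>2)"
      using 1 half_int_square(1) by (intro sum_mono) blast
    then show ?thesis
      using span F(2) by simp
  next
    case 2
    define n where "n e = \<lfloor>x \<bullet> e\<rfloor>" for e
    have n: "x \<bullet> e = of_int (n e)" if "e \<in> F" for e
      using 2 that by (metis Ints_cases floor_of_int n_def)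
    have half: "d \<bullet> e = 1/2 \<or> d \<bullet> e = -1/2" if "e \<in> F" for e
      by (rule half_root_coordinates[OF F(1) d that])
    define s :: "'a \<Rightarrow> int" where "s e = (if d \<bullet> e = 1/2 then 1 else -1)" for e
    have s: "d \<bullet> e = of_int (s e) / 2" if "e \<in> F" for e
      using half[OF that] by (auto simp: s_def)
    have "(\<Sum>e\<in>F. (d \<bullet> e)\<^sup>2) = (\<Sum>e\<in>F. 1/4)"
      by (intro sum.cong refl half_square half)
    then have "d = (\<Sum>e\<in>F. (d \<bullet> e) *\<^sub>R e)"
      using F(2) dL(2) by (intro D_frame_bessel(2)[OF F(1)]) simp
    then have "x \<bullet> d = x \<bullet> (\<Sum>e\<in>F. (d \<bullet> e) *\<^sub>R e)"
      by (rule arg_cong)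
    also have "\<dots> = (\<Sum>e\<in>F. of_int (s e * n e) / 2)"
      by (simp add: inner_sum_right s n)
    finally have "x \<bullet> d = of_int (\<Sum>e\<in>F. s e * n e) / 2"
      by (simp add: sum_divide_distrib)
    moreover have "x \<bullet> d \<in> \<int>"
      using integral_groupD(4)[OF L xL(1) dL(1)] .
    then obtain m where "x \<bullet> d = of_int m"
      by (rule Ints_cases)
    ultimately have "of_int (\<Sum>e\<in>F. s e * n e) = (of_int (2 * m) :: real)"
      by simp
    then have "(\<Sum>e\<in>F. s e * n e) = 2 * m"
      by (rule of_int_eq_iff[THEN iffD1])
    then have "even (\<Sum>e\<in>F. s e * n e)"
      by simp
    moreover have "even ((\<Sum>e\<in>F. (n e)\<^sup>2) - (\<Sum>e\<in>F. s e * n e))"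
      unfolding sum_subtractf[symmetric] by (rule dvd_sum) (auto simp: s_def power2_eq_square)
    ultimately have ev: "even (\<Sum>e\<in>F. (n e)\<^sup>2)"
      by presburger
    have sq: "(\<Sum>e\<in>F. (x \<bullet> e)\<^sup>2) = of_int (\<Sum>e\<in>F. (n e)\<^sup>2)"
      by (simp add: n)
    show ?thesis
    proof (cases "(\<Sum>e\<in>F. (n e)\<^sup>2) = 0")
      case True
      then have "n e = 0" if "e \<in> F" for e
        using sum_nonneg_eq_0_iff[OF fin, of "\<lambda>e. (n e)\<^sup>2"] that by simp
      then show ?thesis
        by (simp add: n)
    next
      case False
      moreover have "0 \<le> (\<Sum>e\<in>F. (n e)\<^sup>2)"
        by (simp add: sum_nonneg)
      ultimately have "2 \<le> (\<Sum>e\<in>F. (n e)\<^sup>2)"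
        using ev by presburger
      then have "of_int 2 \<le> (\<Sum>e\<in>F. (x \<bullet> e)\<^sup>2)"
        unfolding sq by (rule of_int_le_iff[THEN iffD2])
      then show ?thesis
        using span by simp
    qed
  qed
qed

lemma card_roots_le_if_has_E8:
  assumes L: "integral_group L" "finite (roots L)" "L \<subseteq> U" "subspace U" and E8: "has_E8 L"
    and IH: "\<And>V. subspace V \<Longrightarrow> dim V + 8 = dim U \<Longrightarrow> card (roots (L \<inter> V)) \<le> f_bound (dim V)"
  shows "card (roots L) \<le> 240 + f_bound (dim U - 8)" "8 \<le> dim U"
proof -
  obtain F d where F: "D_frame L F" "card F = 8" and d: "d \<in> roots L" "\<forall>e\<in>F. d \<bullet> e - 1/2 \<in> \<int>"
    using E8 unfolding has_E8_def by blast
  have FU: "F \<subseteq> U"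
    using D_frame_subset[OF L(1) F(1) _ L(3,4)] F(2) by simp
  have ind: "independent F"
    using F(1) by (rule D_frame_independent)
  define V where "V = {x\<in>U. \<forall>e\<in>F. x \<bullet> e = 0}"
  have V: "subspace V" "dim V + 8 = dim U"
    using dim_orthogonal_complement_in[OF L(4) FU ind] F(2) by (auto simp: V_def)
  have "roots L \<subseteq> roots (L \<inter> span F) \<union> roots (L \<inter> V)"
    using E8_frame_splits[OF L(1) F d] L(3) by (auto simp: roots_def V_def)
  moreover have fin: "finite (roots (L \<inter> W))" for W
    using L(2) by (rule rev_finite_subset) (auto simp: roots_def)
  ultimately have "card (roots L) \<le> card (roots (L \<inter> span F)) + card (roots (L \<inter> V))"
    by (intro order_trans[OF card_mono card_Un_le] finite_UnI fin)
  moreover have "dim (span F) = 8"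
    using ind F(2) by (simp add: dim_eq_card_independent)
  then have "card (roots (L \<inter> span F)) \<le> 240"
    using card_roots_le_f_bound_small[of "L \<inter> span F" "span F"] fin
      integral_group_restrict[OF L(1), of "span F"] by (simp add: f_bound_def)
  moreover have "card (roots (L \<inter> V)) \<le> f_bound (dim V)"
    by (rule IH[OF V])
  moreover have "dim V = dim U - 8"
    using V(2) by simp
  ultimately show "card (roots L) \<le> 240 + f_bound (dim U - 8)"
    by simp
  show "8 \<le> dim U"
    using V(2) by simp
qed

section \<open>The neighbours of a root\<close>

text \<open>Unit vectors with integral inner products are equal, opposite or orthogonal, so each row of the
  double sum in the trace inequality is at most \<open>2\<close>.\<close>

lemma card_int_units_le:
  fixes S :: "'a::euclidean_space set"
  assumes V: "subspace V" "S \<subseteq> V" and fin: "finite S"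
    and unit: "\<And>u. u \<in> S \<Longrightarrow> u \<bullet> u = 1" and int: "\<And>u v. u \<in> S \<Longrightarrow> v \<in> S \<Longrightarrow> u \<bullet> v \<in> \<int>"
  shows "card S \<le> 2 * dim V"
    and "\<And>u v. u \<in> S \<Longrightarrow> v \<in> S \<Longrightarrow> u = v \<or> u = - v \<or> u \<bullet> v = 0"
proof -
  show cases: "u = v \<or> u = - v \<or> u \<bullet> v = 0" if "u \<in> S" "v \<in> S" for u v
  proof (rule ccontr)
    assume neg: "\<not> ?thesis"
    have "\<bar>u \<bullet> v\<bar> \<le> norm u * norm v"
      by (rule Cauchy_Schwarz_ineq2)
    also have "\<dots> = 1"
      using unit that by (simp add: norm_eq_sqrt_inner)
    finally have le: "\<bar>u \<bullet> v\<bar> \<le> 1" .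
    moreover have "1 \<le> \<bar>u \<bullet> v\<bar>"
      using Ints_nonzero_abs_ge1 int that neg by blast
    ultimately have "u \<bullet> v = 1 \<or> u \<bullet> v = -1"
      by linarith
    then have "(u - v) \<bullet> (u - v) = 0 \<or> (u + v) \<bullet> (u + v) = 0"
      using unit that
      by (auto simp: inner_diff_left inner_diff_right inner_add_left inner_add_right inner_commute)
    then show False
      using neg by (auto simp: eq_neg_iff_add_eq_0)
  qed
  have "(\<Sum>v\<in>S. (u \<bullet> v)\<^sup>2) \<le> 2" if "u \<in> S" for u
  proof -
    have "(\<Sum>v\<in>S. (u \<bullet> v)\<^sup>2) \<le> (\<Sum>v\<in>S. (if v = u then 1 else 0) + (if v = - u then 1 else 0))"
      using cases[OF that] unit[OF that] by (intro sum_mono) fastforce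
    also have "\<dots> \<le> 2"
      using fin that by (simp add: sum.distrib)
    finally show ?thesis .
  qed
  then have "(\<Sum>u\<in>S. \<Sum>v\<in>S. (u \<bullet> v)\<^sup>2) \<le> (\<Sum>u\<in>S. 2)"
    by (rule sum_mono)
  then have "(\<Sum>u\<in>S. u \<bullet> u)\<^sup>2 \<le> real (dim V) * (\<Sum>u\<in>S. 2)"
    using trace_inequality[OF V(1) fin, of "\<lambda>x. x"] V(2)
    by (simp del: sum_constant) (meson mult_left_mono of_nat_0_le_iff order_trans)
  also have "(\<Sum>u\<in>S. u \<bullet> u) = real (card S)"
    using unit by simp
  finally have "real (card S) * real (card S) \<le> real (card S) * (2 * real (dim V))"
    by (simp add: power2_eq_square mult_ac)
  then have "card S * card S \<le> card S * (2 * dim V)"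
    by (metis (mono_tags) of_nat_le_iff of_nat_mult of_nat_numeral)
  then show "card S \<le> 2 * dim V"
    by (cases "card S = 0") auto
qed

text \<open>Neighbours of a root are sorted by their orthogonal projections to the span of a frame with four
  elements. A pillar collects the components orthogonal to the frame of those vectors of \<open>L\<close> that
  have norm \<open>2\<close> and project to a given unit vector \<open>g\<close> of the span (Lemmens and Seidel use this
  word for the corresponding sets of equiangular lines with angle \<open>arccos (1/3)\<close>).\<close>

definition pillar :: "'a::euclidean_space set \<Rightarrow> 'a set \<Rightarrow> 'a \<Rightarrow> 'a set" where
  "pillar L F g = {u. u \<bullet> u = 1 \<and> (\<forall>f\<in>F. u \<bullet> f = 0) \<and> g + u \<in> L}"

lemma pillar_root:
  assumes "D_frame L F" "g \<in> F" "u \<in> pillar L F g"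
  shows "g + u \<in> roots L" "(g + u) \<bullet> g = 1"
proof -
  have "g \<bullet> g = 1" "u \<bullet> u = 1" "u \<bullet> g = 0" "g \<bullet> u = 0" "g + u \<in> L"
    using assms by (simp_all add: pillar_def D_frame_def inner_commute)
  then show "g + u \<in> roots L" "(g + u) \<bullet> g = 1"
    by (simp_all add: roots_def inner_add_left inner_add_right)
qed

lemma finite_pillar:
  assumes "D_frame L F" "g \<in> F" "finite (roots L)"
  shows "finite (pillar L F g)"
proof (rule inj_on_finite)
  show "inj_on (\<lambda>u. g + u) (pillar L F g)"
    by simp
qed (use assms pillar_root(1)[OF assms(1,2)] in auto)

lemma pillar_inner_Ints:
  assumes "integral_group L" "D_frame L F" "g \<in> F" "u \<in> pillar L F g" "v \<in> pillar L F g"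
  shows "u \<bullet> v \<in> \<int>"
proof -
  have "(g + u) \<bullet> (g + v) \<in> \<int>"
    using assms integral_groupD(4) unfolding pillar_def by blast
  moreover have "g \<bullet> g = 1" "u \<bullet> g = 0" "g \<bullet> v = 0"
    using assms by (simp_all add: pillar_def D_frame_def inner_commute)
  then have "(g + u) \<bullet> (g + v) = 1 + u \<bullet> v"
    by (simp add: inner_add_left inner_add_right)
  ultimately have "(1 + u \<bullet> v) - 1 \<in> \<int>"
    by (metis Ints_1 Ints_diff)
  then show ?thesis
    by simp
qed

lemma card_pillar_le:
  assumes L: "integral_group L" "finite (roots L)" "L \<subseteq> U" "subspace U"
    and F: "D_frame L F" "card F = 4" "g \<in> F"
  shows "card (pillar L F g) \<le> 2 * (dim U - 4)"
proof -
  define V where "V = {x\<in>U. \<forall>e\<in>F. x \<bullet> e = 0}"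
  have FU: "F \<subseteq> U"
    using D_frame_subset[OF L(1) F(1) _ L(3,4)] F(2) by simp
  have V: "subspace V" "dim V + 4 = dim U"
    using dim_orthogonal_complement_in[OF L(4) FU D_frame_independent[OF F(1)]] F(2)
    by (auto simp: V_def)
  have "pillar L F g \<subseteq> V"
  proof
    fix u assume u: "u \<in> pillar L F g"
    then have "(g + u) - g \<in> U"
      using L(3,4) FU F(3) by (intro subspace_diff) (auto simp: pillar_def)
    then show "u \<in> V"
      using u by (simp add: pillar_def V_def)
  qed
  then have "card (pillar L F g) \<le> 2 * dim V"
    by (rule card_int_units_le(1)[OF V(1) _ finite_pillar[OF F(1,3) L(2)]])
      (auto intro: pillar_inner_Ints[OF L(1) F(1,3)] simp: pillar_def[of L F g])
  then show ?thesis
    using V(2) by simp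
qed

text \<open>Five elements of a pillar contain three mutually orthogonal ones; these extend the frame to
  seven elements, and the half-integral root supplies the eighth.\<close>

lemma large_pillar_has_E8:
  assumes L: "integral_group L" "finite (roots L)"
    and F: "D_frame L F" "card F = 4" "g \<in> F"
    and P: "5 \<le> card (pillar L F g)" and d: "d \<in> roots L" "d \<bullet> g - 1/2 \<in> \<int>"
  shows "has_E8 L"
proof -
  let ?P = "pillar L F g"
  have orth: "u = v \<or> u = - v \<or> u \<bullet> v = 0" if "u \<in> ?P" "v \<in> ?P" for u v
    by (rule card_int_units_le(2)[OF subspace_UNIV subset_UNIV finite_pillar[OF F(1,3) L(2)]
        _ pillar_inner_Ints[OF L(1) F(1,3)] that]) (simp_all add: pillar_def)
  have avoid: "\<exists>u\<in>?P. u \<notin> set X" if "length X \<le> 4" for X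
  proof (rule ccontr)
    assume "\<not> ?thesis"
    then have "card ?P \<le> card (set X)"
      by (intro card_mono) auto
    then show False
      using P that card_length[of X] by simp
  qed
  obtain u1 where u1: "u1 \<in> ?P"
    using avoid[of "[]"] by auto
  obtain u2 where u2: "u2 \<in> ?P" "u2 \<notin> {u1, - u1}"
    using avoid[of "[u1, - u1]"] by auto
  obtain u3 where u3: "u3 \<in> ?P" "u3 \<notin> {u1, - u1, u2, - u2}"
    using avoid[of "[u1, - u1, u2, - u2]"] by auto
  have o: "u2 \<bullet> u1 = 0" "u3 \<bullet> u1 = 0" "u3 \<bullet> u2 = 0"
    using orth u1 u2 u3 by blast+
  have u: "u1 \<bullet> u1 = 1" "u2 \<bullet> u2 = 1" "u3 \<bullet> u3 = 1" "g + u1 \<in> L" "g + u2 \<in> L" "g + u3 \<in> L"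
    "\<And>f. f \<in> F \<Longrightarrow> u1 \<bullet> f = 0" "\<And>f. f \<in> F \<Longrightarrow> u2 \<bullet> f = 0" "\<And>f. f \<in> F \<Longrightarrow> u3 \<bullet> f = 0"
    using u1 u2(1) u3(1) by (auto simp: pillar_def)
  have fin: "finite F"
    using F(1) by (simp add: D_frame_def)
  have F1: "D_frame L (insert u1 F)" "u1 \<notin> F"
    using D_frame_insert[OF L(1) F(1) _ F(3) u(1) u(7) u(4)] F(2) by simp_all
  have p2: "u2 \<bullet> f = 0" if "f \<in> insert u1 F" for f
    using that o(1) u(8) by auto
  have c1: "card (insert u1 F) = 5"
    using fin F(2) F1(2) by simp
  have F2: "D_frame L (insert u2 (insert u1 F))" "u2 \<notin> insert u1 F"
    using D_frame_insert[OF L(1) F1(1) _ _ u(2) p2 u(5)] c1 F(3) by simp_all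
  have p3: "u3 \<bullet> f = 0" if "f \<in> insert u2 (insert u1 F)" for f
    using that o(2,3) u(9) by auto
  have c2: "card (insert u2 (insert u1 F)) = 6"
    using fin c1 F2(2) by simp
  have F3: "D_frame L (insert u3 (insert u2 (insert u1 F)))" "u3 \<notin> insert u2 (insert u1 F)"
    using D_frame_insert[OF L(1) F2(1) _ _ u(3) p3 u(6)] c2 F(3) by simp_all
  have c3: "card (insert u3 (insert u2 (insert u1 F))) = 7"
    using fin c2 F3(2) by simp
  have "\<forall>e\<in>insert u3 (insert u2 (insert u1 F)). d \<bullet> e - 1/2 \<in> \<int>"
    using d F(3) by (intro D_frame_all_half[OF L(1) F3(1), of d g]) (auto simp: c3 roots_def)
  then show ?thesis
    by (rule seven_frame_has_E8[OF L(1) F3(1) c3 d(1)])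
qed

lemma D_frame_4:
  assumes L: "integral_group L"
    and unit: "e1 \<bullet> e1 = 1" "e2 \<bullet> e2 = 1" "e3 \<bullet> e3 = 1" "e4 \<bullet> e4 = 1"
    and orth: "e1 \<bullet> e2 = 0" "e1 \<bullet> e3 = 0" "e1 \<bullet> e4 = 0" "e2 \<bullet> e3 = 0" "e2 \<bullet> e4 = 0" "e3 \<bullet> e4 = 0"
    and mem: "e1 + e2 \<in> L" "e1 - e2 \<in> L" "e1 + e3 \<in> L" "e1 + e4 \<in> L"
  shows "D_frame L {e1, e2, e3, e4}" "card {e1, e2, e3, e4} = 4"
proof -
  have neq: "e1 \<noteq> e2" "e1 \<noteq> e3" "e1 \<noteq> e4" "e2 \<noteq> e3" "e2 \<noteq> e4" "e3 \<noteq> e4"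
    using unit orth by auto
  have "D_frame L {e1, e2}"
    using unit orth mem L integral_groupD(5)[OF L mem(2)]
    by (auto simp: D_frame_def inner_commute add.commute)
  then have "D_frame L (insert e3 {e1, e2})"
    by (rule D_frame_insert(1)[OF L, of _ e1]) (use unit orth mem neq in \<open>auto simp: inner_commute\<close>)
  then have "D_frame L (insert e4 (insert e3 {e1, e2}))"
    by (rule D_frame_insert(1)[OF L, of _ e1])
      (use unit orth mem neq in \<open>auto simp: inner_commute card_insert_if\<close>)
  also have "insert e4 (insert e3 {e1, e2}) = {e1, e2, e3, e4}"
    by auto
  finally show "D_frame L {e1, e2, e3, e4}" .
  show "card {e1, e2, e3, e4} = 4"
    using neq by simp
qed

lemma D_frame_4D:
  assumes "D_frame L {e1, e2, e3, e4}" "card {e1, e2, e3, e4} = 4"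
  shows "e1 \<bullet> e1 = 1" "e2 \<bullet> e2 = 1" "e3 \<bullet> e3 = 1" "e4 \<bullet> e4 = 1"
    "e1 \<bullet> e2 = 0" "e1 \<bullet> e3 = 0" "e1 \<bullet> e4 = 0" "e2 \<bullet> e3 = 0" "e2 \<bullet> e4 = 0" "e3 \<bullet> e4 = 0"
    "e1 + e2 \<in> L" "e1 - e2 \<in> L" "e1 + e3 \<in> L" "e1 - e3 \<in> L" "e1 + e4 \<in> L" "e1 - e4 \<in> L"
    "e2 + e3 \<in> L" "e2 - e3 \<in> L" "e2 + e4 \<in> L" "e2 - e4 \<in> L" "e3 + e4 \<in> L" "e3 - e4 \<in> L"
    "distinct [e1, e2, e3, e4]"
proof -
  have "distinct [e1, e2, e3, e4]"
    using assms(2) by (intro card_distinct) simp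
  then have neq: "e1 \<noteq> e2" "e1 \<noteq> e3" "e1 \<noteq> e4" "e2 \<noteq> e3" "e2 \<noteq> e4" "e3 \<noteq> e4"
    by auto
  then show "e1 \<bullet> e1 = 1" "e2 \<bullet> e2 = 1" "e3 \<bullet> e3 = 1" "e4 \<bullet> e4 = 1"
    "e1 \<bullet> e2 = 0" "e1 \<bullet> e3 = 0" "e1 \<bullet> e4 = 0" "e2 \<bullet> e3 = 0" "e2 \<bullet> e4 = 0" "e3 \<bullet> e4 = 0"
    "e1 + e2 \<in> L" "e1 - e2 \<in> L" "e1 + e3 \<in> L" "e1 - e3 \<in> L" "e1 + e4 \<in> L" "e1 - e4 \<in> L"
    "e2 + e3 \<in> L" "e2 - e3 \<in> L" "e2 + e4 \<in> L" "e2 - e4 \<in> L" "e3 + e4 \<in> L" "e3 - e4 \<in> L"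
    "distinct [e1, e2, e3, e4]"
    using assms(1) by (auto simp: D_frame_def)
qed

text \<open>Triality: the four vectors \<open>(e1 \<plusminus> e2 \<plusminus> e3 \<plusminus> e4) / 2\<close> with an even number of minus signs form
  another frame of the same \<open>D4\<close>.\<close>

lemma D_frame_triality:
  assumes L: "integral_group L" and F: "D_frame L {e1, e2, e3, e4}" "card {e1, e2, e3, e4} = 4"
    and h: "h + h = e1 + e2 + e3 + e4"
  shows "D_frame L {h, h - (e3 + e4), h - (e2 + e4), h - (e2 + e3)}"
    and "card {h, h - (e3 + e4), h - (e2 + e4), h - (e2 + e3)} = 4"
    and "h \<bullet> e1 = 1/2" "h \<bullet> e2 = 1/2" "h \<bullet> e3 = 1/2" "h \<bullet> e4 = 1/2"
proof -
  note e = D_frame_4D[OF F]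
  note comm = inner_commute[of e2 e1] inner_commute[of e3 e1] inner_commute[of e4 e1]
    inner_commute[of e3 e2] inner_commute[of e4 e2] inner_commute[of e4 e3]
    inner_commute[of e1 h] inner_commute[of e2 h] inner_commute[of e3 h] inner_commute[of e4 h]
  have "(h + h) \<bullet> e1 = 1" "(h + h) \<bullet> e2 = 1" "(h + h) \<bullet> e3 = 1" "(h + h) \<bullet> e4 = 1"
    unfolding h by (simp_all add: inner_add_left e comm)
  then show he: "h \<bullet> e1 = 1/2" "h \<bullet> e2 = 1/2" "h \<bullet> e3 = 1/2" "h \<bullet> e4 = 1/2"
    by (simp_all add: inner_add_left)
  have "h \<bullet> (h + h) = 2"
    unfolding h by (simp add: inner_add_right he)
  then have hh: "h \<bullet> h = 1"
    by (simp add: inner_add_right)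
  have m: "h + (h - (e3 + e4)) \<in> L" "h - (h - (e3 + e4)) \<in> L"
    "h + (h - (e2 + e4)) \<in> L" "h + (h - (e2 + e3)) \<in> L"
    unfolding add_diff_eq h using e by (simp_all add: algebra_simps)
  show "D_frame L {h, h - (e3 + e4), h - (e2 + e4), h - (e2 + e3)}"
    and "card {h, h - (e3 + e4), h - (e2 + e4), h - (e2 + e3)} = 4"
    by (rule D_frame_4[OF L]; (rule m)?;
        simp add: inner_diff_left inner_diff_right inner_add_left inner_add_right he hh e comm)+
qed

lemma D_frame_4_bessel:
  assumes "D_frame L {e1, e2, e3, e4}" "card {e1, e2, e3, e4} = 4"
  shows "(x \<bullet> e1)\<^sup>2 + (x \<bullet> e2)\<^sup>2 + (x \<bullet> e3)\<^sup>2 + (x \<bullet> e4)\<^sup>2 \<le> x \<bullet> x"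
    and "x \<bullet> x \<le> (x \<bullet> e1)\<^sup>2 + (x \<bullet> e2)\<^sup>2 + (x \<bullet> e3)\<^sup>2 + (x \<bullet> e4)\<^sup>2 \<Longrightarrow>
      x = (x \<bullet> e1) *\<^sub>R e1 + (x \<bullet> e2) *\<^sub>R e2 + (x \<bullet> e3) *\<^sub>R e3 + (x \<bullet> e4) *\<^sub>R e4"
proof -
  have d: "distinct [e1, e2, e3, e4]"
    by (rule D_frame_4D[OF assms])
  have sum4: "(\<Sum>e\<in>{e1, e2, e3, e4}. f e) = f e1 + f e2 + f e3 + f e4"
    for f :: "'a \<Rightarrow> 'b::comm_monoid_add"
    using d by (simp add: add.assoc)
  show "(x \<bullet> e1)\<^sup>2 + (x \<bullet> e2)\<^sup>2 + (x \<bullet> e3)\<^sup>2 + (x \<bullet> e4)\<^sup>2 \<le> x \<bullet> x"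
    using D_frame_bessel(1)[OF assms(1), of x] unfolding sum4 .
  show "x = (x \<bullet> e1) *\<^sub>R e1 + (x \<bullet> e2) *\<^sub>R e2 + (x \<bullet> e3) *\<^sub>R e3 + (x \<bullet> e4) *\<^sub>R e4"
    if "x \<bullet> x \<le> (x \<bullet> e1)\<^sup>2 + (x \<bullet> e2)\<^sup>2 + (x \<bullet> e3)\<^sup>2 + (x \<bullet> e4)\<^sup>2"
    using D_frame_bessel(2)[OF assms(1), of x] that unfolding sum4 by (rule meta_mp)
qed

lemma pillar_memI:
  assumes "a \<in> roots L" "g \<bullet> g = 1" "a \<bullet> g = 1" "\<And>f. f \<in> F \<Longrightarrow> a \<bullet> f = g \<bullet> f"
  shows "a \<in> (\<lambda>u. g + u) ` pillar L F g"
proof (rule image_eqI[of _ _ "a - g"])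
  have "(a - g) \<bullet> (a - g) = 1"
    using assms(1-3) by (simp add: roots_def inner_diff_left inner_diff_right inner_commute[of g a])
  then show "a - g \<in> pillar L F g"
    using assms(1,4) by (simp add: pillar_def roots_def inner_diff_left)
qed simp

text \<open>Coordinates of a neighbour of \<open>e1 + e2\<close> with respect to the frame are
  \<open>(1, 0, *, *)\<close>, \<open>(0, 1, *, *)\<close> or \<open>(1/2, 1/2, \<plusminus>1/2, \<plusminus>1/2)\<close>. The involution that sends a neighbour
  \<open>a\<close> to \<open>e1 + e2 - a\<close> exchanges the first two cases and changes the sign of the third coordinate.
  So, up to this involution, the neighbour belongs to the \<open>D4\<close> of the frame or projects to one of
  the three unit vectors \<open>e1\<close>, \<open>h\<close> and \<open>h'\<close>, which correspond to each other under triality.\<close>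

lemma neighbours_subset_pillars:
  fixes e1 :: "'a::euclidean_space"
  assumes L: "integral_group L" and F: "D_frame L {e1, e2, e3, e4}" "card {e1, e2, e3, e4} = 4"
    and h: "h + h = e1 + e2 + e3 + e4" and h': "h' + h' = e1 + e2 + e3 - e4"
    and hh: "h \<bullet> h = 1" "h' \<bullet> h' = 1"
    and he: "h \<bullet> e1 = 1/2" "h \<bullet> e2 = 1/2" "h \<bullet> e3 = 1/2" "h \<bullet> e4 = 1/2"
      "h' \<bullet> e1 = 1/2" "h' \<bullet> e2 = 1/2" "h' \<bullet> e3 = 1/2" "h' \<bullet> e4 = -1/2"
  defines "F \<equiv> {e1, e2, e3, e4}"
  defines "E \<equiv> set [e1 + e3, e1 - e3, e1 + e4, e1 - e4] \<union> (\<lambda>u. e1 + u) ` pillar L F e1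
      \<union> (\<lambda>u. h + u) ` pillar L F h \<union> (\<lambda>u. h' + u) ` pillar L F h'"
  shows "neighbours L (e1 + e2) \<subseteq> E \<union> (\<lambda>a. (e1 + e2) - a) ` E"
proof
  note e = D_frame_4D[OF F]
  have c2: "2 \<le> card {e1, e2, e3, e4}"
    using F(2) by simp
  have b: "e1 + e2 \<in> roots L"
    using e by (simp add: roots_def inner_add_left inner_add_right inner_commute[of e2 e1])
  have root: "a \<in> roots L" "a \<bullet> a = 2" "a \<in> L" "a \<bullet> e1 + a \<bullet> e2 = 1"
    if "a \<in> neighbours L (e1 + e2)" for a
    using that by (auto simp: neighbours_def roots_def inner_add_right)
  have int: "a \<in> E" if a: "a \<in> neighbours L (e1 + e2)" and a1: "a \<bullet> e1 = 1" for a
  proof -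
    note r = root[OF a]
    have a2: "a \<bullet> e2 = 0"
      using r a1 by simp
    have "a \<bullet> e3 \<in> \<int>" "a \<bullet> e4 \<in> \<int>"
      using D_frame_all_int[OF L F(1) c2 r(3), of e1] a1 by auto
    then have sq: "a \<bullet> e3 \<noteq> 0 \<Longrightarrow> 1 \<le> (a \<bullet> e3)\<^sup>2" "a \<bullet> e4 \<noteq> 0 \<Longrightarrow> 1 \<le> (a \<bullet> e4)\<^sup>2"
      by (auto intro: int_square_ge_1)
    have le: "1 + (a \<bullet> e3)\<^sup>2 + (a \<bullet> e4)\<^sup>2 \<le> 2"
      using D_frame_4_bessel(1)[OF F, of a] a1 a2 r(2) by simp
    consider "a \<bullet> e3 = 0" "a \<bullet> e4 = 0" | "a \<bullet> e3 \<noteq> 0" | "a \<bullet> e4 \<noteq> 0"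
      by blast
    then show ?thesis
    proof cases
      case 1
      have "a \<in> (\<lambda>u. e1 + u) ` pillar L F e1"
        by (rule pillar_memI[OF r(1)]) (auto simp: F_def e a1 a2 1)
      then show ?thesis
        by (simp add: E_def)
    next
      case 2
      then have "(a \<bullet> e3)\<^sup>2 = 1" "(a \<bullet> e4)\<^sup>2 = 0"
        using sq(1) le zero_le_power2[of "a \<bullet> e4"] by linarith+
      then have 3: "a \<bullet> e3 = 1 \<or> a \<bullet> e3 = -1" "a \<bullet> e4 = 0"
        by (simp_all add: power2_eq_1_iff)
      have "a = (a \<bullet> e1) *\<^sub>R e1 + (a \<bullet> e2) *\<^sub>R e2 + (a \<bullet> e3) *\<^sub>R e3 + (a \<bullet> e4) *\<^sub>R e4"
        by (rule D_frame_4_bessel(2)[OF F]) (simp add: r(2) a1 a2 \<open>(a \<bullet> e3)\<^sup>2 = 1\<close>)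
      then have "a = e1 + (a \<bullet> e3) *\<^sub>R e3"
        unfolding a1 a2 3(2) by (simp only: scaleR_one scaleR_zero_left add_0_right)
      then have "a = e1 + e3 \<or> a = e1 - e3"
        using 3(1) by (metis add_uminus_conv_diff scaleR_minus1_left scaleR_one)
      then show ?thesis
        by (auto simp: E_def)
    next
      case 3
      then have "(a \<bullet> e4)\<^sup>2 = 1" "(a \<bullet> e3)\<^sup>2 = 0"
        using sq(2) le zero_le_power2[of "a \<bullet> e3"] by linarith+
      then have 4: "a \<bullet> e4 = 1 \<or> a \<bullet> e4 = -1" "a \<bullet> e3 = 0"
        by (simp_all add: power2_eq_1_iff)
      have "a = (a \<bullet> e1) *\<^sub>R e1 + (a \<bullet> e2) *\<^sub>R e2 + (a \<bullet> e3) *\<^sub>R e3 + (a \<bullet> e4) *\<^sub>R e4"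
        by (rule D_frame_4_bessel(2)[OF F]) (simp add: r(2) a1 a2 \<open>(a \<bullet> e4)\<^sup>2 = 1\<close>)
      then have "a = e1 + (a \<bullet> e4) *\<^sub>R e4"
        unfolding a1 a2 4(2) by (simp only: scaleR_one scaleR_zero_left add_0_right)
      then have "a = e1 + e4 \<or> a = e1 - e4"
        using 4(1) by (metis add_uminus_conv_diff scaleR_minus1_left scaleR_one)
      then show ?thesis
        by (auto simp: E_def)
    qed
  qed
  have coords: "a \<bullet> e1 = 1/2 \<and> a \<bullet> e2 = 1/2 \<and> (a \<bullet> e3 = 1/2 \<or> a \<bullet> e3 = -1/2)
      \<and> (a \<bullet> e4 = 1/2 \<or> a \<bullet> e4 = -1/2)"
    if a: "a \<in> neighbours L (e1 + e2)" and half: "\<forall>f\<in>{e1, e2, e3, e4}. a \<bullet> f - 1/2 \<in> \<int>" for a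
  proof -
    have "a \<bullet> f = 1/2 \<or> a \<bullet> f = -1/2" if "f \<in> {e1, e2, e3, e4}" for f
      by (rule half_root_coordinates[OF F(1) root(1)[OF a] half that])
    then have "a \<bullet> e1 = 1/2 \<or> a \<bullet> e1 = -1/2" "a \<bullet> e2 = 1/2 \<or> a \<bullet> e2 = -1/2"
      "a \<bullet> e3 = 1/2 \<or> a \<bullet> e3 = -1/2" "a \<bullet> e4 = 1/2 \<or> a \<bullet> e4 = -1/2"
      by blast+
    then show ?thesis
      using root(4)[OF a] by linarith
  qed
  have half: "a \<in> E" if a: "a \<in> neighbours L (e1 + e2)" and a3: "a \<bullet> e3 = 1/2" for a
  proof -
    note r = root[OF a]
    have "\<forall>f\<in>{e1, e2, e3, e4}. a \<bullet> f - 1/2 \<in> \<int>"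
      by (rule D_frame_all_half[OF L F(1) c2 r(3), of e3]) (simp_all add: a3)
    then have c: "a \<bullet> e1 = 1/2" "a \<bullet> e2 = 1/2" "a \<bullet> e4 = 1/2 \<or> a \<bullet> e4 = -1/2"
      using coords[OF a] by blast+
    from c(3) show ?thesis
    proof
      assume a4: "a \<bullet> e4 = 1/2"
      have "a \<bullet> (h + h) = 2"
        unfolding h by (simp add: inner_add_right c a3 a4)
      then have ah: "a \<bullet> h = 1"
        by (simp add: inner_add_right)
      have "a \<in> (\<lambda>u. h + u) ` pillar L F h"
        by (rule pillar_memI[OF r(1) hh(1) ah]) (auto simp: F_def he c(1,2) a3 a4)
      then show ?thesis
        by (simp add: E_def)
    next
      assume a4: "a \<bullet> e4 = -1/2"
      have "a \<bullet> (h' + h') = 2"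
        unfolding h' by (simp add: inner_add_right inner_diff_right c(1,2) a3 a4)
      then have ah: "a \<bullet> h' = 1"
        by (simp add: inner_add_right)
      have "a \<in> (\<lambda>u. h' + u) ` pillar L F h'"
        by (rule pillar_memI[OF r(1) hh(2) ah]) (auto simp: F_def he c(1,2) a3 a4)
      then show ?thesis
        by (simp add: E_def)
    qed
  qed
  fix a assume a: "a \<in> neighbours L (e1 + e2)"
  note r = root[OF a]
  have refl: "(e1 + e2) - a \<in> neighbours L (e1 + e2)"
    by (rule neighbours_reflect[OF L b a])
  have refl_coords: "((e1 + e2) - a) \<bullet> e1 = a \<bullet> e2" "((e1 + e2) - a) \<bullet> e3 = - (a \<bullet> e3)"
    using r(4) e by (simp_all add: inner_diff_left inner_add_left inner_commute[of e2 e1])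
  have "a \<in> E \<or> (e1 + e2) - a \<in> E"
    using D_frame_coordinates[OF L F(1) c2 r(3)]
  proof
    assume "\<forall>f\<in>{e1, e2, e3, e4}. a \<bullet> f \<in> \<int>"
    then have i: "a \<bullet> e1 \<in> \<int>" "a \<bullet> e2 \<in> \<int>"
      by auto
    have "(a \<bullet> e1)\<^sup>2 + (a \<bullet> e2)\<^sup>2 \<le> 2"
      using D_frame_4_bessel(1)[OF F, of a] zero_le_power2[of "a \<bullet> e3"] zero_le_power2[of "a \<bullet> e4"]
      unfolding r(2) by linarith
    moreover have "a \<bullet> e2 = 1 - a \<bullet> e1"
      using r(4) by linarith
    ultimately have sq: "(a \<bullet> e1)\<^sup>2 + (1 - a \<bullet> e1)\<^sup>2 \<le> 2"
      by (rule back_subst[of "\<lambda>t. (a \<bullet> e1)\<^sup>2 + t\<^sup>2 \<le> 2"])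
    then have "(a \<bullet> e1)\<^sup>2 \<le> 2"
      using zero_le_power2[of "1 - a \<bullet> e1"] by linarith
    then have "\<bar>a \<bullet> e1\<bar> \<le> 2"
      using abs_le_square_iff[of "a \<bullet> e1" 2] by simp
    then have "a \<bullet> e1 = -2 \<or> a \<bullet> e1 = -1 \<or> a \<bullet> e1 = 0 \<or> a \<bullet> e1 = 1 \<or> a \<bullet> e1 = 2"
      by (rule Ints_abs_le_2_cases[OF i(1)])
    then have "a \<bullet> e1 = 1 \<or> a \<bullet> e1 = 0"
      using sq by (elim disjE) simp_all
    then have "a \<bullet> e1 = 1 \<or> a \<bullet> e2 = 1"
      using r(4) by linarith
    then show ?thesis
      using int[OF a] int[OF refl] refl_coords(1) by auto
  next
    assume "\<forall>f\<in>{e1, e2, e3, e4}. a \<bullet> f - 1/2 \<in> \<int>"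
    then have "a \<bullet> e3 = 1/2 \<or> a \<bullet> e3 = -1/2"
      using coords[OF a] by blast
    then show ?thesis
      using half[OF a] half[OF refl] refl_coords(2) by auto
  qed
  then show "a \<in> E \<union> (\<lambda>a. (e1 + e2) - a) ` E"
  proof
    assume "(e1 + e2) - a \<in> E"
    moreover have "a = (e1 + e2) - ((e1 + e2) - a)"
      by simp
    ultimately show ?thesis
      by blast
  qed blast
qed

text \<open>Let \<open>p\<close>, \<open>q\<close>, \<open>r\<close> be the sizes of the three pillars; there are at most \<open>8 + 2 * (p + q + r)\<close>
  neighbours. If two pillars are nonempty, each of them provides a root that is half-integral for the
  frames of the other two, so that no pillar has more than four elements unless \<open>E8\<close> appears; this
  gives \<open>8 + 2 * 12 = 32\<close>, and \<open>32 = 4 * 9 - 4\<close>. If only one pillar is nonempty, it has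
  at most \<open>2 * (dim U - 4)\<close> elements, which gives \<open>4 * dim U - 8\<close>.\<close>

lemma card_neighbours_D4:
  fixes e1 :: "'a::euclidean_space"
  assumes L: "integral_group L" "finite (roots L)" "L \<subseteq> U" "subspace U" and dim: "9 \<le> dim U"
    and F: "D_frame L {e1, e2, e3, e4}" "card {e1, e2, e3, e4} = 4"
  shows "has_E8 L \<or> card (neighbours L (e1 + e2)) \<le> 4 * dim U - 4"
proof -
  note e = D_frame_4D[OF F]
  let ?F = "{e1, e2, e3, e4}"
  define h where "h = (1/2) *\<^sub>R (e1 + e2 + e3 + e4)"
  define h' where "h' = (1/2) *\<^sub>R (e1 + e2 + e3 - e4)"
  have h: "h + h = e1 + e2 + e3 + e4" and h'0: "h' + h' = e1 + e2 + e3 - e4"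
    by (simp_all add: h_def h'_def flip: scaleR_left_distrib)
  then have h': "h' + h' = e1 + e2 + e3 + - e4"
    by simp
  have F': "D_frame L {e1, e2, e3, - e4}" "card {e1, e2, e3, - e4} = 4"
    by (rule D_frame_4[OF L(1)]; simp add: e)+
  define Fh where "Fh = {h, h - (e3 + e4), h - (e2 + e4), h - (e2 + e3)}"
  define Fh' where "Fh' = {h', h' - (e3 + - e4), h' - (e2 + - e4), h' - (e2 + e3)}"
  note T = D_frame_triality[OF L(1) F h, folded Fh_def]
  note T' = D_frame_triality[OF L(1) F' h', folded Fh'_def]
  have hF: "h \<in> Fh" "h' \<in> Fh'"
    by (simp_all add: Fh_def Fh'_def)
  have hh: "h \<bullet> h = 1" "h' \<bullet> h' = 1"
    using T(1) T'(1) hF by (simp_all add: D_frame_def)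
  have he: "h' \<bullet> e4 = -1/2"
    using T'(6) by simp
  note comm = inner_commute[of e1 h] inner_commute[of e1 h'] inner_commute[of h' h]
  have "h \<bullet> (h' + h') = 1"
    unfolding h'0 by (simp add: inner_add_right inner_diff_right T(3-6))
  then have hh': "h \<bullet> h' = 1/2"
    by (simp add: inner_add_right)
  \<comment> \<open>Each pillar is seen through the frame that contains its base point.\<close>
  define P where "P = pillar L ?F e1"
  define Ph where "Ph = pillar L Fh h"
  define Ph' where "Ph' = pillar L Fh' h'"
  have perp: "u \<bullet> e1 = 0 \<and> u \<bullet> e2 = 0 \<and> u \<bullet> e3 = 0 \<and> u \<bullet> e4 = 0 \<and> u \<bullet> h = 0 \<and> u \<bullet> h' = 0"
    if "u \<in> pillar L ?F g" for u g
  proof -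
    have u: "u \<bullet> e1 = 0" "u \<bullet> e2 = 0" "u \<bullet> e3 = 0" "u \<bullet> e4 = 0"
      using that by (simp_all add: pillar_def)
    show ?thesis
      by (simp add: h_def h'_def inner_add_right inner_diff_right u)
  qed
  have sub: "pillar L ?F h \<subseteq> Ph" "pillar L ?F h' \<subseteq> Ph'"
  proof -
    show "pillar L ?F h \<subseteq> Ph"
    proof
      fix u assume u: "u \<in> pillar L ?F h"
      then have p: "u \<bullet> e2 = 0" "u \<bullet> e3 = 0" "u \<bullet> e4 = 0" "u \<bullet> h = 0"
        using perp by blast+
      have "\<forall>f\<in>Fh. u \<bullet> f = 0"
        unfolding Fh_def by (simp add: inner_diff_right inner_add_right p)
      then show "u \<in> Ph"
        using u unfolding Ph_def pillar_def by blast
    qed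
    show "pillar L ?F h' \<subseteq> Ph'"
    proof
      fix u assume u: "u \<in> pillar L ?F h'"
      then have p: "u \<bullet> e2 = 0" "u \<bullet> e3 = 0" "u \<bullet> e4 = 0" "u \<bullet> h' = 0"
        using perp by blast+
      have "\<forall>f\<in>Fh'. u \<bullet> f = 0"
        unfolding Fh'_def by (simp add: inner_diff_right inner_add_right p)
      then show "u \<in> Ph'"
        using u unfolding Ph'_def pillar_def by blast
    qed
  qed
  have fin: "finite P" "finite Ph" "finite Ph'"
    unfolding P_def Ph_def Ph'_def
    by (rule finite_pillar[OF F(1) _ L(2)] finite_pillar[OF T(1) hF(1) L(2)]
        finite_pillar[OF T'(1) hF(2) L(2)]; simp)+
  define p q r where "p = card P" and "q = card (pillar L ?F h)" and "r = card (pillar L ?F h')"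
  have qr: "q \<le> card Ph" "r \<le> card Ph'"
    unfolding q_def r_def using sub fin by (simp_all add: card_mono)
  have bound: "p \<le> 2 * (dim U - 4)" "q \<le> 2 * (dim U - 4)" "r \<le> 2 * (dim U - 4)"
  proof -
    show "p \<le> 2 * (dim U - 4)"
      unfolding p_def P_def by (rule card_pillar_le[OF L F]) simp
    show "q \<le> 2 * (dim U - 4)" "r \<le> 2 * (dim U - 4)"
      using qr card_pillar_le[OF L T(1,2) hF(1)] card_pillar_le[OF L T'(1,2) hF(2)]
      unfolding Ph_def Ph'_def by linarith+
  qed
  have elem: "\<exists>d\<in>roots L. d \<bullet> h - 1/2 \<in> \<int> \<and> d \<bullet> h' - 1/2 \<in> \<int>" if "p \<noteq> 0"
  proof -
    have "P \<noteq> {}"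
      using that by (auto simp: p_def)
    then obtain u where u: "u \<in> P"
      by blast
    then have "e1 + u \<in> roots L"
      unfolding P_def by (intro pillar_root(1)[OF F(1)]) auto
    moreover have "u \<bullet> h = 0" "u \<bullet> h' = 0"
      using u perp unfolding P_def by blast+
    ultimately show ?thesis
      by (intro bexI[of _ "e1 + u"]) (simp_all add: inner_add_left comm T(3) T'(3))
  qed
  have elemh: "\<exists>d\<in>roots L. d \<bullet> e1 - 1/2 \<in> \<int> \<and> d \<bullet> h' - 1/2 \<in> \<int>" if "q \<noteq> 0"
  proof -
    have "pillar L ?F h \<noteq> {}"
      using that by (auto simp: q_def)
    then obtain u where u: "u \<in> pillar L ?F h"
      by blast
    then have "h + u \<in> roots L"
      using sub pillar_root(1)[OF T(1) hF(1)] by (auto simp: Ph_def)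
    moreover have "u \<bullet> e1 = 0" "u \<bullet> h' = 0"
      using u perp by blast+
    ultimately show ?thesis
      by (intro bexI[of _ "h + u"]) (simp_all add: inner_add_left T(3) hh')
  qed
  have elemh': "\<exists>d\<in>roots L. d \<bullet> e1 - 1/2 \<in> \<int> \<and> d \<bullet> h - 1/2 \<in> \<int>" if "r \<noteq> 0"
  proof -
    have "pillar L ?F h' \<noteq> {}"
      using that by (auto simp: r_def)
    then obtain u where u: "u \<in> pillar L ?F h'"
      by blast
    then have "h' + u \<in> roots L"
      using sub pillar_root(1)[OF T'(1) hF(2)] by (auto simp: Ph'_def)
    moreover have "u \<bullet> e1 = 0" "u \<bullet> h = 0"
      using u perp by blast+
    ultimately show ?thesis
      by (intro bexI[of _ "h' + u"]) (simp_all add: inner_add_left comm T'(3) hh')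
  qed
  have "p \<le> 4" if "q \<noteq> 0 \<or> r \<noteq> 0" "\<not> has_E8 L"
  proof (rule ccontr)
    assume "\<not> p \<le> 4"
    then have "5 \<le> card (pillar L ?F e1)"
      by (simp add: p_def P_def)
    then show False
      using large_pillar_has_E8[OF L(1,2) F, of e1] elemh elemh' that by blast
  qed
  moreover have "q \<le> 4" if "p \<noteq> 0 \<or> r \<noteq> 0" "\<not> has_E8 L"
  proof (rule ccontr)
    assume "\<not> q \<le> 4"
    then have "5 \<le> card (pillar L Fh h)"
      using qr(1) by (simp add: Ph_def)
    then show False
      using large_pillar_has_E8[OF L(1,2) T(1,2) hF(1)] elem elemh' that by blast
  qed
  moreover have "r \<le> 4" if "p \<noteq> 0 \<or> q \<noteq> 0" "\<not> has_E8 L"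
  proof (rule ccontr)
    assume "\<not> r \<le> 4"
    then have "5 \<le> card (pillar L Fh' h')"
      using qr(2) by (simp add: Ph'_def)
    then show False
      using large_pillar_has_E8[OF L(1,2) T'(1,2) hF(2)] elem elemh that by blast
  qed
  ultimately have sum: "p + q + r \<le> 2 * dim U - 6" if "\<not> has_E8 L"
    using bound dim that by linarith
  define E where "E = set [e1 + e3, e1 - e3, e1 + e4, e1 - e4] \<union> (\<lambda>u. e1 + u) ` P
      \<union> (\<lambda>u. h + u) ` pillar L ?F h \<union> (\<lambda>u. h' + u) ` pillar L ?F h'"
  have "neighbours L (e1 + e2) \<subseteq> E \<union> (\<lambda>a. (e1 + e2) - a) ` E"
    unfolding E_def P_def
    by (rule neighbours_subset_pillars[OF L(1) F h h'0 hh T(3-6) T'(3-5) he])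
  moreover have fin4: "finite (pillar L ?F h)" "finite (pillar L ?F h')"
    using sub fin finite_subset by blast+
  then have "finite E"
    unfolding E_def using fin by blast
  ultimately have "card (neighbours L (e1 + e2)) \<le> card (E \<union> (\<lambda>a. (e1 + e2) - a) ` E)"
    by (intro card_mono) auto
  also have "\<dots> \<le> card E + card ((\<lambda>a. (e1 + e2) - a) ` E)"
    by (rule card_Un_le)
  also have "\<dots> \<le> card E + card E"
    using card_image_le[OF \<open>finite E\<close>] by simp
  finally have "card (neighbours L (e1 + e2)) \<le> 2 * card E"
    by simp
  moreover have "card E \<le> 4 + p + q + r"
  proof -
    have "card (set [e1 + e3, e1 - e3, e1 + e4, e1 - e4]) \<le> 4"
      using card_length[of "[e1 + e3, e1 - e3, e1 + e4, e1 - e4]"] by simp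
    moreover have "card ((\<lambda>u. e1 + u) ` P) \<le> p" "card ((\<lambda>u. h + u) ` pillar L ?F h) \<le> q"
      "card ((\<lambda>u. h' + u) ` pillar L ?F h') \<le> r"
      unfolding p_def q_def r_def using fin fin4 by (simp_all add: card_image_le)
    ultimately show ?thesis
      unfolding E_def
      by (intro order_trans[OF card_Un_le] add_mono) simp_all
  qed
  ultimately show ?thesis
    using sum dim by linarith
qed

text \<open>A linear relation between vectors with Gram matrix \<open>I + J\<close> is trivial.\<close>

lemma card_equiangular_roots_le:
  fixes S :: "'a::euclidean_space set"
  assumes S: "finite S" "S \<subseteq> U" and norm: "\<And>x. x \<in> S \<Longrightarrow> x \<bullet> x = 2"
    and inner: "\<And>x y. x \<in> S \<Longrightarrow> y \<in> S \<Longrightarrow> x \<noteq> y \<Longrightarrow> x \<bullet> y = 1"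
  shows "card S \<le> dim U"
proof -
  have "c w = 0" if c: "(\<Sum>v\<in>S. c v *\<^sub>R v) = 0" and w: "w \<in> S" for c w
  proof -
    define t where "t = (\<Sum>v\<in>S. c v)"
    have cw: "c w = - t" if "w \<in> S" for w
    proof -
      have "0 = (\<Sum>v\<in>S. c v *\<^sub>R v) \<bullet> w"
        using c by simp
      also have "\<dots> = (\<Sum>v\<in>S. c v + (if v = w then c w else 0))"
        unfolding inner_sum_left using norm inner that by (intro sum.cong) auto
      also have "\<dots> = t + c w"
        using S(1) that by (simp add: sum.distrib t_def)
      finally show ?thesis
        by simp
    qed
    have "t = (\<Sum>v\<in>S. - t)"
      by (subst t_def) (rule sum.cong[OF refl cw])
    then have "t * (1 + real (card S)) = 0"
      by (simp add: algebra_simps)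
    moreover have "1 + real (card S) > 0"
      by simp
    ultimately have "t = 0"
      by (metis less_irrefl mult_eq_0_iff)
    then show ?thesis
      using cw[OF w] by simp
  qed
  then have "independent S"
    using S(1) by (simp add: independent_explicit)
  then show ?thesis
    by (rule independent_card_le_dim[OF S(2)])
qed

text \<open>Fix a neighbour \<open>d\<close>. Replacing neighbours \<open>a\<close> by \<open>b - a\<close> where necessary, half of them have
  inner product \<open>1\<close> with \<open>d\<close>. Two of these that were orthogonal would form an orthogonal triple with
  \<open>b - d\<close>.\<close>

lemma card_neighbours_no_triple:
  assumes L: "integral_group L" "finite (roots L)" "L \<subseteq> U" and b: "b \<in> roots L"
    and no: "\<And>a1 a2 a3. a1 \<in> neighbours L b \<Longrightarrow> a2 \<in> neighbours L b \<Longrightarrow> a3 \<in> neighbours L b \<Longrightarrow>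
      a1 \<bullet> a2 = 0 \<Longrightarrow> a1 \<bullet> a3 = 0 \<Longrightarrow> a2 \<bullet> a3 = 0 \<Longrightarrow> False"
  shows "card (neighbours L b) \<le> 2 * dim U"
proof (cases "neighbours L b = {}")
  case False
  let ?N = "neighbours L b"
  obtain d where d: "d \<in> ?N"
    using False by blast
  define B where "B = {a\<in>?N. a \<bullet> d \<ge> 1}"
  have N: "a \<bullet> a = 2" "a \<bullet> b = 1" "b \<bullet> a = 1" "a \<in> U" if "a \<in> ?N" for a
    using that L(3) by (auto simp: neighbours_def roots_def inner_commute)
  note refl = neighbours_reflect[OF L(1) b]
  have ind: "a \<bullet> a' = 1" if a: "a \<in> B" "a' \<in> B" "a \<noteq> a'" for a a'
  proof -
    have m: "a \<in> ?N" "a' \<in> ?N" "a \<bullet> d \<ge> 1" "a' \<bullet> d \<ge> 1"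
      using a by (auto simp: B_def)
    have ad: "x = d \<or> x \<bullet> d = 1" if "x \<in> ?N" "x \<bullet> d \<ge> 1" for x
    proof -
      have "d \<noteq> b - x"
        using that N[OF that(1)] by (auto simp: inner_diff_right)
      then show ?thesis
        using neighbours_inner_cases[OF L(1) b that(1) d] that(2) by auto
    qed
    have "a' \<noteq> b - a"
    proof
      assume "a' = b - a"
      then have "a' \<bullet> d = 1 - a \<bullet> d"
        using N[OF d] by (simp add: inner_diff_left)
      then show False
        using m(3,4) by simp
    qed
    then consider "a \<bullet> a' = 1" | "a \<bullet> a' = 0"
      using neighbours_inner_cases[OF L(1) b m(1,2)] a(3) by blast
    then show ?thesis
    proof cases
      case 2
      then have "a \<noteq> d" "a' \<noteq> d"
        using m(3,4) by (auto simp: inner_commute)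
      then have "a \<bullet> d = 1" "a' \<bullet> d = 1"
        using ad m by blast+
      then have "a \<bullet> (b - d) = 0" "a' \<bullet> (b - d) = 0"
        using N m by (simp_all add: inner_diff_right)
      then show ?thesis
        using no[OF m(1,2) refl[OF d]] 2 by blast
    qed
  qed
  have finB: "finite B"
    using finite_neighbours[OF L(2), of b] by (simp add: B_def)
  have cardB: "card B \<le> dim U"
    by (rule card_equiangular_roots_le[OF finB _ _ ind]) (use N in \<open>auto simp: B_def\<close>)
  have "?N \<subseteq> B \<union> (\<lambda>a. b - a) ` B"
  proof
    fix a assume a: "a \<in> ?N"
    have "b - a \<in> B" if "a \<notin> B"
    proof -
      have "a = b - d \<or> a \<bullet> d = 0"
        using neighbours_inner_cases[OF L(1) b d a] that a N[OF a] by (auto simp: B_def inner_commute)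
      then show ?thesis
        using refl[OF a] N[OF d] by (auto simp: B_def inner_diff_left)
    qed
    moreover have "a = b - (b - a)"
      by simp
    ultimately show "a \<in> B \<union> (\<lambda>a. b - a) ` B"
      by blast
  qed
  then have "card ?N \<le> card (B \<union> (\<lambda>a. b - a) ` B)"
    using finB by (intro card_mono) auto
  also have "\<dots> \<le> card B + card ((\<lambda>a. b - a) ` B)"
    by (rule card_Un_le)
  also have "\<dots> \<le> card B + card B"
    using card_image_le[OF finB] by simp
  finally show ?thesis
    using cardB by linarith
qed simp

text \<open>An orthogonal triple of neighbours of \<open>b\<close> generates together with \<open>b\<close> a \<open>D4\<close>; without such a
  triple there are few neighbours anyway.\<close>

lemma card_neighbours_le_or_has_E8:
  assumes L: "integral_group L" "finite (roots L)" "L \<subseteq> U" "subspace U" and dim: "9 \<le> dim U"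
    and b: "b \<in> roots L"
  shows "has_E8 L \<or> card (neighbours L b) \<le> 4 * dim U - 4"
proof (cases "\<exists>a1\<in>neighbours L b. \<exists>a2\<in>neighbours L b. \<exists>a3\<in>neighbours L b.
    a1 \<bullet> a2 = 0 \<and> a1 \<bullet> a3 = 0 \<and> a2 \<bullet> a3 = 0")
  case False
  then have "card (neighbours L b) \<le> 2 * dim U"
    by (intro card_neighbours_no_triple[OF L(1-3) b]) blast
  then show ?thesis
    using dim by linarith
next
  case True
  then obtain a1 a2 a3 where a: "a1 \<in> neighbours L b" "a2 \<in> neighbours L b" "a3 \<in> neighbours L b"
    and orth: "a1 \<bullet> a2 = 0" "a1 \<bullet> a3 = 0" "a2 \<bullet> a3 = 0"
    by blast
  have n: "a1 \<bullet> a1 = 2" "a2 \<bullet> a2 = 2" "a3 \<bullet> a3 = 2" "b \<bullet> b = 2"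
    "a1 \<bullet> b = 1" "a2 \<bullet> b = 1" "a3 \<bullet> b = 1" "b \<bullet> a1 = 1" "b \<bullet> a2 = 1" "b \<bullet> a3 = 1"
    "a1 \<in> L" "a2 \<in> L" "a3 \<in> L" "b \<in> L"
    using a b by (auto simp: neighbours_def roots_def inner_commute)
  note o = orth orth[unfolded inner_commute[of a1 a2] inner_commute[of a1 a3] inner_commute[of a2 a3]]
  \<comment> \<open>These vectors solve \<open>a1 = e1 + e3\<close>, \<open>a2 = e1 - e3\<close>, \<open>b = e1 + e2\<close> and \<open>a3 = e2 + e4\<close>.\<close>
  define e1 where "e1 = (1/2) *\<^sub>R (a1 + a2)"
  define e3 where "e3 = (1/2) *\<^sub>R (a1 - a2)"
  define e2 where "e2 = b - e1"
  define e4 where "e4 = a3 - e2"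
  note defs = e4_def e2_def e1_def e3_def
  note inners = inner_add_left inner_add_right inner_diff_left inner_diff_right n o
  have dbl: "e1 + e1 = a1 + a2"
    by (simp add: e1_def flip: scaleR_left_distrib)
  have e13: "e1 + e3 = a1"
    by (simp add: e1_def e3_def flip: scaleR_right_distrib)
  have e12': "e1 - e2 = a1 + a2 - b"
    unfolding e2_def using dbl by (simp add: algebra_simps)
  have "e1 + e4 = a3 + (e1 - e2)"
    by (simp add: e4_def)
  then have e14: "e1 + e4 = a3 + (a1 + a2 - b)"
    by (simp only: e12')
  have e12: "e1 + e2 = b"
    by (simp add: e2_def)
  have mem: "e1 + e2 \<in> L" "e1 - e2 \<in> L" "e1 + e3 \<in> L" "e1 + e4 \<in> L"
    unfolding e12 e12' e13 e14
    using n integral_groupD(2,3)[OF L(1)] by blast+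
  have F: "D_frame L {e1, e2, e3, e4}" "card {e1, e2, e3, e4} = 4"
    by (rule D_frame_4[OF L(1) _ _ _ _ _ _ _ _ _ _ mem]; simp add: defs inners)+
  show ?thesis
    using card_neighbours_D4[OF L dim F] by (simp only: e12)
qed

section \<open>The upper bound\<close>

text \<open>Splitting off \<open>m\<close> orthogonal unit vectors, which contribute \<open>2 * m\<^sup>2\<close> vectors, never beats
  \<^const>\<open>f_bound\<close>; the next lemma says the same about splitting off \<open>E8\<close>.\<close>

lemma f_bound_add_square: "f_bound j + 2 * m\<^sup>2 \<le> f_bound (j + m)"
proof (cases "j + m \<le> 11")
  case True
  have "\<forall>j\<in>set [0..<12]. \<forall>m\<in>set [0..<12]. f_bound j + 2 * m\<^sup>2 \<le> f_bound (j + m)"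
    by code_simp
  then show ?thesis
    using True by simp
next
  case False
  then have f: "f_bound (j + m) = 2 * (j + m)\<^sup>2"
    by (simp add: f_bound_def)
  show ?thesis
  proof (cases "7 \<le> j \<and> j \<le> 11")
    case True
    then have "j \<in> {7, 8, 9, 10, 11}"
      by auto
    then show ?thesis
      unfolding f using False
      by (elim insertE emptyE) (simp_all add: f_bound_def power2_sum)
  next
    case False
    then have "f_bound j = 2 * j\<^sup>2"
      by (auto simp: f_bound_def)
    then show ?thesis
      unfolding f by (simp add: power2_sum)
  qed
qed

lemma f_bound_add_8: "240 + f_bound j \<le> f_bound (j + 8)"
proof (cases "7 \<le> j \<and> j \<le> 11")
  case True
  then have "j \<in> {7, 8, 9, 10, 11}"
    by auto
  then show ?thesis
    by (elim insertE emptyE) (simp_all add: f_bound_def)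
next
  case False
  then have "f_bound j = 2 * j\<^sup>2"
    by (auto simp: f_bound_def)
  then show ?thesis
    using f_bound_add_square[of 8 j] by (simp add: f_bound_def add.commute)
qed

lemma square_le_f_bound: "2 * k\<^sup>2 \<le> f_bound k"
  using f_bound_add_square[of 0 k] by (simp add: f_bound_def)

text \<open>Above dimension \<open>8\<close>, either \<open>E8\<close> splits off and induction applies to its orthogonal complement, or
  every root has at most \<open>4 * dim U - 4\<close> neighbours, and then the trace inequality gives
  \<open>2 * (dim U)\<^sup>2\<close>.\<close>

lemma card_roots_le_f_bound:
  assumes "integral_group L" "finite (roots L)" "L \<subseteq> U" "subspace U"
  shows "card (roots L) \<le> f_bound (dim U)"
  using assms
proof (induction "dim U" arbitrary: L U rule: less_induct)
  case less
  note L = less.prems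
  consider "dim U \<le> 8" | "9 \<le> dim U" "has_E8 L" | "9 \<le> dim U" "\<not> has_E8 L"
    by linarith
  then show ?case
  proof cases
    case 1
    then show ?thesis
      by (rule card_roots_le_f_bound_small[OF L])
  next
    case 2
    have "card (roots (L \<inter> V)) \<le> f_bound (dim V)" if V: "subspace V" "dim V + 8 = dim U" for V
    proof (rule less.hyps)
      show "finite (roots (L \<inter> V))"
        using L(2) by (rule rev_finite_subset) (auto simp: roots_def)
    qed (use V integral_group_restrict[OF L(1) V(1)] in auto)
    then have "card (roots L) \<le> 240 + f_bound (dim U - 8)"
      by (rule card_roots_le_if_has_E8[OF L 2(2)])
    also have "\<dots> \<le> f_bound (dim U)"
      using f_bound_add_8[of "dim U - 8"] 2(1) by simp
    finally show ?thesis .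
  next
    case 3
    then have "2 * card (roots L) \<le> dim U * (4 + (4 * dim U - 4))"
      using card_neighbours_le_or_has_E8[OF L] by (intro card_roots_le[OF L]) blast
    also have "\<dots> = 2 * (2 * (dim U)\<^sup>2)"
      using 3(1) by (simp add: power2_eq_square)
    finally have "card (roots L) \<le> 2 * (dim U)\<^sup>2"
      by simp
    then show ?thesis
      using square_le_f_bound order_trans by blast
  qed
qed

definition units :: "'a::euclidean_space set \<Rightarrow> 'a set" where
  "units L = {x\<in>L. x \<bullet> x = 1}"

lemma finite_units_Int: "finite (units L) \<Longrightarrow> finite (units (L \<inter> V))"
  by (rule rev_finite_subset) (auto simp: units_def)

lemma finite_roots_Int: "finite (roots L) \<Longrightarrow> finite (roots (L \<inter> V))"
  by (rule rev_finite_subset) (auto simp: roots_def)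

text \<open>A unit vector \<open>e\<close> splits off: \<open>x - (x \<bullet> e) *\<^sub>R e\<close> lies in the group for every element \<open>x\<close>. The
  roots that are not orthogonal to \<open>e\<close> are the vectors \<open>\<plusminus>e + u\<close> with a unit vector \<open>u\<close> orthogonal
  to \<open>e\<close>.\<close>

lemma card_units_roots_split:
  assumes L: "integral_group L" "finite (roots L)" "finite (units L)" and e: "e \<in> units L"
    and V: "V = {x\<in>U. x \<bullet> e = 0}" and U: "L \<subseteq> U"
  shows "card (units L) = 2 + card (units (L \<inter> V))"
    and "card (roots L) \<le> card (roots (L \<inter> V)) + 2 * card (units (L \<inter> V))"
proof -
  have ee: "e \<bullet> e = 1" "e \<in> L" "- e \<in> L"
    using e integral_groupD(5)[OF L(1)] by (auto simp: units_def)
  have unit_cases: "u = e \<or> u = - e \<or> u \<bullet> e = 0" if "u \<in> units L" for u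
    by (rule card_int_units_le(2)[OF subspace_UNIV subset_UNIV L(3) _ _ that e])
      (auto simp: units_def integral_groupD(4)[OF L(1)])
  have units: "units L = {e, - e} \<union> units (L \<inter> V)"
    using unit_cases ee U by (auto simp: units_def V)
  have fin: "finite (units (L \<inter> V))" "finite (roots (L \<inter> V))"
    using L(2,3) by (simp_all add: finite_roots_Int finite_units_Int)
  have ne: "e \<noteq> - e"
  proof
    assume "e = - e"
    then have "e \<bullet> e = - (e \<bullet> e)"
      by (metis inner_minus_left)
    then show False
      using ee(1) by simp
  qed
  have "{e, - e} \<inter> units (L \<inter> V) = {}"
    using ee(1) by (auto simp: units_def V)
  then have "card (units L) = card {e, - e} + card (units (L \<inter> V))"
    unfolding units using fin(1) by (intro card_Un_disjoint) auto
  then show "card (units L) = 2 + card (units (L \<inter> V))"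
    using ne by simp
  have "roots L \<subseteq> roots (L \<inter> V) \<union> ((\<lambda>u. e + u) ` units (L \<inter> V) \<union> (\<lambda>u. - e + u) ` units (L \<inter> V))"
  proof
    fix x assume x: "x \<in> roots L"
    then have xL: "x \<in> L" "x \<bullet> x = 2"
      by (auto simp: roots_def)
    have "D_frame L {e}"
      using ee(1) by (simp add: D_frame_def)
    then have sq: "(x \<bullet> e)\<^sup>2 \<le> 2"
      using D_frame_bessel(1)[of L "{e}" x] xL(2) by simp
    then have "\<bar>x \<bullet> e\<bar> \<le> 2"
      using abs_le_square_iff[of "x \<bullet> e" 2] by simp
    then have "x \<bullet> e = -2 \<or> x \<bullet> e = -1 \<or> x \<bullet> e = 0 \<or> x \<bullet> e = 1 \<or> x \<bullet> e = 2"
      by (rule Ints_abs_le_2_cases[OF integral_groupD(4)[OF L(1) xL(1) ee(2)]])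
    then consider "x \<bullet> e = 0" | "x \<bullet> e = 1" | "x \<bullet> e = -1"
      using sq by fastforce
    then show "x \<in> roots (L \<inter> V) \<union> ((\<lambda>u. e + u) ` units (L \<inter> V) \<union> (\<lambda>u. - e + u) ` units (L \<inter> V))"
    proof cases
      case 1
      then show ?thesis
        using x U by (auto simp: roots_def V)
    next
      case 2
      then have "e \<bullet> x = 1"
        by (simp add: inner_commute)
      then have "x - e \<in> units (L \<inter> V)"
        using xL ee 2 U integral_groupD(3)[OF L(1) xL(1) ee(2)]
        by (auto simp: units_def V inner_diff_left inner_diff_right)
      moreover have "x = e + (x - e)"
        by simp
      ultimately show ?thesis
        by blast
    next
      case 3
      then have "e \<bullet> x = -1"
        by (simp add: inner_commute)
      then have "x + e \<in> units (L \<inter> V)"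
        using xL ee 3 U integral_groupD(2)[OF L(1) xL(1) ee(2)]
        by (auto simp: units_def V inner_add_left inner_add_right)
      moreover have "x = - e + (x + e)"
        by simp
      ultimately show ?thesis
        by blast
    qed
  qed
  then have "card (roots L) \<le> card (roots (L \<inter> V)
      \<union> ((\<lambda>u. e + u) ` units (L \<inter> V) \<union> (\<lambda>u. - e + u) ` units (L \<inter> V)))"
    using fin by (intro card_mono) auto
  also have "\<dots> \<le> card (roots (L \<inter> V))
      + (card ((\<lambda>u. e + u) ` units (L \<inter> V)) + card ((\<lambda>u. - e + u) ` units (L \<inter> V)))"
    by (intro order_trans[OF card_Un_le] add_mono card_Un_le order_refl)
  also have "\<dots> \<le> card (roots (L \<inter> V)) + (card (units (L \<inter> V)) + card (units (L \<inter> V)))"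
    using fin(1) by (intro add_mono card_image_le order_refl)
  finally show "card (roots L) \<le> card (roots (L \<inter> V)) + 2 * card (units (L \<inter> V))"
    by simp
qed

text \<open>Splitting off the unit vectors one after the other: if there are \<open>2 * m\<close> of them, they and their
  sums are \<open>2 * m + 2 * m * (m - 1) = 2 * m\<^sup>2\<close> vectors, and all other roots lie in the orthogonal
  complement, of dimension \<open>dim U - m\<close>.\<close>

lemma card_units_roots_le:
  assumes "integral_group L" "finite (roots L)" "finite (units L)" "L \<subseteq> U" "subspace U"
  shows "\<exists>m\<le>dim U. card (units L) = 2 * m \<and> card (units L) + card (roots L) \<le> 2 * m\<^sup>2 + f_bound (dim U - m)"
  using assms
proof (induction "dim U" arbitrary: L U)
  case 0
  then have "L \<subseteq> {0}"
    by (auto simp: dim_eq_0)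
  then have "units L = {}" "roots L = {}"
    by (auto simp: units_def roots_def)
  then show ?case
    by simp
next
  case (Suc k)
  note L = Suc.prems
  show ?case
  proof (cases "units L = {}")
    case True
    then show ?thesis
      using card_roots_le_f_bound[OF L(1,2,4,5)] by (intro exI[of _ 0]) simp
  next
    case False
    then obtain e where e: "e \<in> units L"
      by blast
    define V where "V = {x\<in>U. x \<bullet> e = 0}"
    have "e \<in> U" "e \<noteq> 0"
      using e L(4) by (auto simp: units_def)
    then have V: "subspace V" "dim V + 1 = dim U"
      using dim_orthogonal_complement_in[OF L(5), of "{e}"] by (auto simp: V_def)
    have fin: "finite (units (L \<inter> V))" "finite (roots (L \<inter> V))"
      using L(2,3) by (simp_all add: finite_roots_Int finite_units_Int)
    have k: "k = dim V"
      using V(2) Suc.hyps(2) by simp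
    obtain m where m: "m \<le> dim V" "card (units (L \<inter> V)) = 2 * m"
      "card (units (L \<inter> V)) + card (roots (L \<inter> V)) \<le> 2 * m\<^sup>2 + f_bound (dim V - m)"
      using Suc.hyps(1)[OF k integral_group_restrict[OF L(1) V(1)] fin(2,1) _ V(1)] by auto
    note split = card_units_roots_split[OF L(1-3) e V_def L(4)]
    have "dim U - (m + 1) = dim V - m"
      using V(2) by simp
    moreover have "2 * (m + 1)\<^sup>2 = 2 * m\<^sup>2 + 4 * m + 2"
      by (simp add: power2_eq_square)
    ultimately show ?thesis
      using split m V(2) by (intro exI[of _ "m + 1"]) simp
  qed
qed

definition int_span :: "'a::real_vector set \<Rightarrow> 'a set" where
  "int_span B = {y. \<exists>c :: 'a \<Rightarrow> int. y = (\<Sum>b\<in>B. of_int (c b) *\<^sub>R b)}"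

lemma add_group_int_span: "add_group (int_span B)"
  unfolding add_group_def
proof (intro conjI ballI)
  show "0 \<in> int_span B"
    by (auto simp: int_span_def intro!: exI[of _ "\<lambda>_. 0"])
  fix x y assume xy: "x \<in> int_span B" "y \<in> int_span B"
  obtain c :: "'a \<Rightarrow> int" where c: "x = (\<Sum>b\<in>B. of_int (c b) *\<^sub>R b)"
    using xy(1) unfolding int_span_def by blast
  obtain d :: "'a \<Rightarrow> int" where d: "y = (\<Sum>b\<in>B. of_int (d b) *\<^sub>R b)"
    using xy(2) unfolding int_span_def by blast
  have "x - y = (\<Sum>b\<in>B. of_int (c b - d b) *\<^sub>R b)"
    by (simp add: c d scaleR_left_diff_distrib sum_subtractf)
  then show "x - y \<in> int_span B"
    unfolding int_span_def mem_Collect_eq by (rule exI[of _ "\<lambda>b. c b - d b"])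
qed

lemma integral_lattice_imp_integral_group:
  assumes "integral_lattice L"
  shows "integral_group L"
proof -
  obtain B where "L = int_span B"
    using assms unfolding integral_lattice_def is_lattice_def int_span_def by blast
  then show ?thesis
    using assms add_group_int_span by (auto simp: integral_group_def integral_lattice_def)
qed

lemma finite_units_roots:
  fixes L :: "(real ^ 'n) set"
  assumes "integral_lattice L"
  shows "finite (units L)" "finite (roots L)"
  by (rule finite_subset[OF _ finite_N_le2[OF assms]];
      auto simp: units_def roots_def power2_norm_eq_inner)+

lemma N_le2_eq:
  fixes L :: "(real ^ 'n) set"
  assumes "integral_lattice L"
  shows "N_le2 L = 1 + card (units L) + card (roots L)"
proof -
  note G = integral_lattice_imp_integral_group[OF assms]
  note fin = finite_units_roots[OF assms]
  have "x \<bullet> x \<le> 2 \<longleftrightarrow> x = 0 \<or> x \<bullet> x = 1 \<or> x \<bullet> x = 2" if "x \<in> L" for x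
  proof
    assume "x \<bullet> x \<le> 2"
    then have "\<bar>x \<bullet> x\<bar> \<le> 2"
      by simp
    then have "x \<bullet> x = -2 \<or> x \<bullet> x = -1 \<or> x \<bullet> x = 0 \<or> x \<bullet> x = 1 \<or> x \<bullet> x = 2"
      by (rule Ints_abs_le_2_cases[OF integral_groupD(4)[OF G that that]])
    then show "x = 0 \<or> x \<bullet> x = 1 \<or> x \<bullet> x = 2"
      using inner_ge_zero[of x] by auto
  qed auto
  then have eq: "{y \<in> L. (norm y)\<^sup>2 \<le> 2} = insert 0 (units L \<union> roots L)"
    using integral_groupD(1)[OF G] by (auto simp: power2_norm_eq_inner units_def roots_def)
  have "card (units L \<union> roots L) = card (units L) + card (roots L)"
    using fin by (intro card_Un_disjoint) (auto simp: units_def roots_def)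
  moreover have "0 \<notin> units L \<union> roots L"
    by (simp add: units_def roots_def)
  ultimately show ?thesis
    unfolding N_le2_def eq using fin by simp
qed

lemma N_le2_le:
  fixes L :: "(real ^ 'n) set"
  assumes "integral_lattice L"
  shows "N_le2 L \<le> f_bound CARD('n) + 1"
proof -
  obtain m where m: "m \<le> CARD('n)"
    "card (units L) + card (roots L) \<le> 2 * m\<^sup>2 + f_bound (CARD('n) - m)"
    using card_units_roots_le[OF integral_lattice_imp_integral_group[OF assms]
        finite_units_roots(2,1)[OF assms] subset_UNIV subspace_UNIV] by auto
  then show ?thesis
    using f_bound_add_square[of "CARD('n) - m" m] N_le2_eq[OF assms] by simp
qed

section \<open>Subgroups of lattices\<close>

lemma int_span_subset_span: "int_span B \<subseteq> span B"
  by (auto simp: int_span_def intro: span_sum span_scale span_base)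

lemma int_span_base:
  assumes "finite B" "b \<in> B"
  shows "b \<in> int_span B"
proof -
  have "(\<Sum>a\<in>B. of_int (if a = b then 1 else 0) *\<^sub>R a) = (\<Sum>a\<in>B. if a = b then b else 0)"
    by (intro sum.cong) auto
  also have "\<dots> = b"
    using assms by simp
  finally have "b = (\<Sum>a\<in>B. of_int (if a = b then 1 else 0) *\<^sub>R a)" ..
  then show ?thesis
    unfolding int_span_def mem_Collect_eq by (rule exI[of _ "\<lambda>a. if a = b then 1 else 0"])
qed

lemma int_span_insert:
  assumes "finite C" "v \<notin> C"
  shows "x \<in> int_span (insert v C) \<longleftrightarrow> (\<exists>n. x - of_int n *\<^sub>R v \<in> int_span C)"
proof
  assume "x \<in> int_span (insert v C)"
  then obtain c :: "'a \<Rightarrow> int" where "x = (\<Sum>b\<in>insert v C. of_int (c b) *\<^sub>R b)"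
    unfolding int_span_def by blast
  then have "x - of_int (c v) *\<^sub>R v = (\<Sum>b\<in>C. of_int (c b) *\<^sub>R b)"
    using assms by simp
  then show "\<exists>n. x - of_int n *\<^sub>R v \<in> int_span C"
    unfolding int_span_def by blast
next
  assume "\<exists>n. x - of_int n *\<^sub>R v \<in> int_span C"
  then obtain n and c :: "'a \<Rightarrow> int" where c: "x - of_int n *\<^sub>R v = (\<Sum>b\<in>C. of_int (c b) *\<^sub>R b)"
    unfolding int_span_def by blast
  have "(\<Sum>b\<in>insert v C. of_int ((c(v := n)) b) *\<^sub>R b)
      = of_int n *\<^sub>R v + (\<Sum>b\<in>C. of_int ((c(v := n)) b) *\<^sub>R b)"
    using assms by simp
  also have "(\<Sum>b\<in>C. of_int ((c(v := n)) b) *\<^sub>R b) = (\<Sum>b\<in>C. of_int (c b) *\<^sub>R b)"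
    using assms(2) by (intro sum.cong) auto
  finally have "(\<Sum>b\<in>insert v C. of_int ((c(v := n)) b) *\<^sub>R b) = x"
    using c[symmetric] by simp
  then show "x \<in> int_span (insert v C)"
    unfolding int_span_def by blast
qed

text \<open>Induction on the basis: the coefficients at the last basis vector of the elements of the
  subgroup form an ideal of the integers. An element \<open>v\<close> that realises a generator of this ideal
  extends a basis of the elements with coefficient \<open>0\<close>.\<close>

lemma subgroup_of_int_span:
  fixes B :: "'a::euclidean_space set"
  assumes "finite B" "independent B" "add_group H" "H \<subseteq> int_span B"
  shows "\<exists>C. independent C \<and> H = int_span C"
  using assms
proof (induction B arbitrary: H rule: finite_induct)
  case empty
  then have "H = int_span {}"
    using add_groupD(1)[OF empty.prems(2)] by (auto simp: int_span_def)
  then show ?case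
    using independent_empty by blast
next
  case (insert b B)
  have ind: "independent B" "b \<notin> span B"
    using insert.prems(1) insert.hyps(2) by (auto simp: independent_insert)
  note H = add_groupD[OF insert.prems(2)] and S = add_groupD[OF add_group_int_span[of B]]
  define D where "D = {n::int. \<exists>x\<in>H. x - of_int n *\<^sub>R b \<in> int_span B}"
  have coeff: "\<exists>n\<in>D. x - of_int n *\<^sub>R b \<in> int_span B" if "x \<in> H" for x
  proof -
    have "x \<in> int_span (insert b B)"
      using that insert.prems(3) by blast
    then obtain n where "x - of_int n *\<^sub>R b \<in> int_span B"
      unfolding int_span_insert[OF insert.hyps(1,2)] by blast
    with that show ?thesis
      unfolding D_def by blast
  qed
  show ?case
  proof (cases "\<exists>n\<in>D. n \<noteq> 0")
    case False
    have "H \<subseteq> int_span B"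
    proof
      fix x assume "x \<in> H"
      then obtain n where "n \<in> D" "x - of_int n *\<^sub>R b \<in> int_span B"
        using coeff by blast
      moreover from this(1) have "n = 0"
        using False by blast
      ultimately show "x \<in> int_span B"
        by simp
    qed
    then show ?thesis
      by (rule insert.IH[OF ind(1) insert.prems(2)])
  next
    case True
    have neg: "- n \<in> D" if n: "n \<in> D" for n
    proof -
      obtain x where x: "x \<in> H" "x - of_int n *\<^sub>R b \<in> int_span B"
        using n unfolding D_def by blast
      have "- x \<in> H" "- (x - of_int n *\<^sub>R b) \<in> int_span B"
        by (rule H(3)[OF x(1)], rule S(3)[OF x(2)])
      moreover have "- (x - of_int n *\<^sub>R b) = - x - of_int (- n) *\<^sub>R b"
        by simp
      ultimately show ?thesis
        unfolding D_def mem_Collect_eq by (metis (no_types))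
    qed
    define P where "P k \<longleftrightarrow> int k \<in> D \<and> k > 0" for k :: nat
    obtain n where n: "n \<in> D" "n \<noteq> 0"
      using True by blast
    have "\<bar>n\<bar> \<in> D"
      using n(1) neg[OF n(1)] by (simp add: abs_if)
    then have "P (nat \<bar>n\<bar>)"
      using n(2) by (simp add: P_def)
    then have P: "P (Least P)"
      by (rule LeastI)
    have least: "Least P \<le> k" if "P k" for k
      using that by (rule Least_le)
    define d where "d = int (Least P)"
    have d: "d \<in> D" "d > 0"
      using P by (auto simp: d_def P_def)
    obtain v where v: "v \<in> H" "v - of_int d *\<^sub>R b \<in> int_span B"
      using d(1) unfolding D_def by blast
    have group: "add_group (H \<inter> int_span B)"
      using H(1,2) S(1,2) by (auto simp: add_group_def)
    obtain C where C: "independent C" "H \<inter> int_span B = int_span C"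
      using insert.IH[OF ind(1) group] by blast
    have finC: "finite C"
      using C(1) by (rule independent_imp_finite)
    have "C \<subseteq> int_span C"
      using int_span_base[OF finC] by (rule subsetI)
    also have "\<dots> \<subseteq> span B"
      using C(2) int_span_subset_span by blast
    finally have "C \<subseteq> span B" .
    then have CB: "span C \<subseteq> span B"
      by (simp add: span_minimal)
    have vC: "v \<notin> span C"
    proof
      assume "v \<in> span C"
      then have "v \<in> span B"
        using CB by blast
      moreover have "v - of_int d *\<^sub>R b \<in> span B"
        using v(2) int_span_subset_span by blast
      ultimately have "v - (v - of_int d *\<^sub>R b) \<in> span B"
        by (rule span_diff)
      then have "of_int d *\<^sub>R b \<in> span B"
        by simp
      then have "(1 / of_int d) *\<^sub>R (of_int d *\<^sub>R b) \<in> span B"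
        by (rule span_scale)
      then show False
        using ind(2) d(2) by simp
    qed
    then have vC': "v \<notin> C"
      by (rule contrapos_nn) (rule span_base)
    have "x \<in> int_span (insert v C)" if x: "x \<in> H" for x
    proof -
      obtain n where n: "n \<in> D" "x - of_int n *\<^sub>R b \<in> int_span B"
        using coeff[OF x] by blast
      define q where "q = n div d"
      have xq: "x - of_int q *\<^sub>R v \<in> H"
        by (intro H(2) x add_group_scaleR[OF insert.prems(2) v(1)])
      have "(x - of_int n *\<^sub>R b) - of_int q *\<^sub>R (v - of_int d *\<^sub>R b) \<in> int_span B"
        by (intro S(2) n(2) add_group_scaleR[OF add_group_int_span v(2)])
      also have "(x - of_int n *\<^sub>R b) - of_int q *\<^sub>R (v - of_int d *\<^sub>R b)
          = (x - of_int q *\<^sub>R v) - of_int (n - q * d) *\<^sub>R b"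
        by (simp add: scaleR_right_diff_distrib scaleR_left_diff_distrib)
      also have "n - q * d = n mod d"
        by (simp add: q_def minus_div_mult_eq_mod)
      finally have r: "(x - of_int q *\<^sub>R v) - of_int (n mod d) *\<^sub>R b \<in> int_span B" .
      have "n mod d = 0"
      proof (rule ccontr)
        assume "n mod d \<noteq> 0"
        moreover have "0 \<le> n mod d" "n mod d < d"
          using d(2) by simp_all
        moreover have "n mod d \<in> D"
          unfolding D_def mem_Collect_eq by (rule bexI[of _ "x - of_int q *\<^sub>R v"], rule r, rule xq)
        ultimately have "P (nat (n mod d))"
          by (simp add: P_def)
        then have "Least P \<le> nat (n mod d)"
          by (rule least)
        then show False
          using \<open>n mod d < d\<close> \<open>0 \<le> n mod d\<close> by (simp add: d_def)
      qed
      then have "x - of_int q *\<^sub>R v \<in> int_span C"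
        using xq r C(2) by auto
      then show ?thesis
        unfolding int_span_insert[OF finC vC'] by (rule exI)
    qed
    moreover have "x \<in> H" if x: "x \<in> int_span (insert v C)" for x
    proof -
      obtain n where "x - of_int n *\<^sub>R v \<in> int_span C"
        using x unfolding int_span_insert[OF finC vC'] by blast
      then have "(x - of_int n *\<^sub>R v) + of_int n *\<^sub>R v \<in> H"
        using C(2) by (intro H(4)[OF _ add_group_scaleR[OF insert.prems(2) v(1)]]) blast
      then show ?thesis
        by simp
    qed
    ultimately have "H = int_span (insert v C)"
      by (intro subset_antisym subsetI)
    moreover have "independent (insert v C)"
      using C(1) vC by (simp add: independent_insert)
    ultimately show ?thesis
      by blast
  qed
qed

text \<open>The coordinate condition places \<open>H\<close> in the lattice that the orthogonal vectors
  \<open>w i *\<^sub>R axis i 1\<close> span.\<close>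

lemma is_latticeI:
  fixes H :: "(real ^ 'n) set" and w :: "'n \<Rightarrow> real"
  assumes H: "add_group H" and w: "\<And>i. w i \<noteq> 0" and coord: "\<And>x i. x \<in> H \<Longrightarrow> x $ i / w i \<in> \<int>"
  shows "is_lattice H"
proof -
  define b where "b i = w i *\<^sub>R (axis i 1 :: real ^ 'n)" for i :: 'n
  have bb: "b i \<bullet> b j = (if i = j then (w i)\<^sup>2 else 0)" for i j
    by (simp add: b_def inner_axis_axis power2_eq_square)
  have inj: "inj b"
  proof (rule injI)
    fix i j assume "b i = b j"
    then have "b i \<bullet> b i = b i \<bullet> b j"
      by (rule arg_cong)
    then show "i = j"
      using w[of i] unfolding bb by (simp split: if_splits)
  qed
  have "independent (range b)"
  proof (rule pairwise_orthogonal_independent)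
    show "pairwise orthogonal (range b)"
      using bb by (auto simp: pairwise_def orthogonal_def)
    show "0 \<notin> range b"
      using w by (auto simp: b_def axis_eq_0_iff)
  qed
  moreover have "H \<subseteq> int_span (range b)"
  proof
    fix x assume x: "x \<in> H"
    define c where "c y = \<lfloor>(x \<bullet> y) / (y \<bullet> y)\<rfloor>" for y
    have c: "of_int (c (b i)) = x $ i / w i" for i
    proof -
      have "(x \<bullet> b i) / (b i \<bullet> b i) = x $ i / w i"
        using w[of i] by (simp add: bb, simp add: b_def inner_axis power2_eq_square)
      moreover obtain z where "x $ i / w i = of_int z"
        using coord[OF x, of i] by (rule Ints_cases)
      ultimately show ?thesis
        by (simp add: c_def)
    qed
    have "(\<Sum>y\<in>range b. of_int (c y) *\<^sub>R y) = (\<Sum>i\<in>UNIV. of_int (c (b i)) *\<^sub>R b i)"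
      by (simp add: sum.reindex[OF inj])
    also have "\<dots> = (\<Sum>i\<in>UNIV. (x $ i) *s axis i 1)"
      using w by (intro sum.cong refl) (simp add: c, simp add: b_def scalar_mult_eq_scaleR)
    also have "\<dots> = x"
      by (rule basis_expansion)
    finally show "x \<in> int_span (range b)"
      unfolding int_span_def by blast
  qed
  ultimately obtain C where "independent C" "H = int_span C"
    using subgroup_of_int_span[of "range b" H] H by auto
  then show ?thesis
    unfolding is_lattice_def int_span_def by blast
qed

section \<open>Extremal lattices\<close>

lemma integral_latticeI:
  fixes H :: "(real ^ 'n) set" and w :: "'n \<Rightarrow> real"
  assumes "add_group H" "\<And>i. w i \<noteq> 0" "\<And>x i. x \<in> H \<Longrightarrow> x $ i / w i \<in> \<int>"
    and "\<And>x y. x \<in> H \<Longrightarrow> y \<in> H \<Longrightarrow> x \<bullet> y \<in> \<int>"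
  shows "integral_lattice H"
  unfolding integral_lattice_def
proof
  show "is_lattice H"
    using assms(1-3) by (rule is_latticeI)
qed (use assms(4) in blast)

definition axis_units :: "'n::finite set \<Rightarrow> (real ^ 'n) set" where
  "axis_units J = (\<lambda>(s, i). axis i s) ` ({1, -1} \<times> J)"

definition D_roots :: "'n::finite set \<Rightarrow> (real ^ 'n) set" where
  "D_roots J = (\<lambda>(s, i, t, j). axis i s + axis j t) ` {(s, i, t, j). s \<in> {1, -1} \<and> i \<in> J \<and> t \<in> {1, -1} \<and> j \<in> J \<and> i \<noteq> j}"

lemma finite_D_roots: "finite (D_roots J)"
proof -
  have "{(s, i, t, j). s \<in> {1, -1 :: real} \<and> i \<in> J \<and> t \<in> {1, -1 :: real} \<and> j \<in> J \<and> i \<noteq> j}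
      \<subseteq> {1, -1} \<times> UNIV \<times> {1, -1} \<times> UNIV"
    by auto
  then have "finite {(s, i, t, j). s \<in> {1, -1 :: real} \<and> i \<in> J \<and> t \<in> {1, -1 :: real} \<and> j \<in> J \<and> i \<noteq> j}"
    by (rule finite_subset) auto
  then show ?thesis
    unfolding D_roots_def by (rule finite_imageI)
qed

lemma card_axis_units: "card (axis_units J) = 2 * card J"
proof -
  have "inj_on (\<lambda>(s, i). axis i s) ({1, -1 :: real} \<times> J)"
    by (auto simp: inj_on_def axis_eq_axis)
  then have "card (axis_units J) = card ({1, -1 :: real} \<times> J)"
    unfolding axis_units_def by (rule card_image)
  then show ?thesis
    by (simp add: card_cartesian_product)
qed

lemma axis_units_coordinates:
  assumes "x \<in> axis_units J"
  shows "x $ i \<in> \<int>" "i \<notin> J \<Longrightarrow> x $ i = 0" "x \<bullet> x = 1"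
proof -
  obtain s k where x: "x = axis k s" and s: "s \<in> {1, -1}" and k: "k \<in> J"
    using assms by (auto simp: axis_units_def)
  show "x $ i \<in> \<int>" "i \<notin> J \<Longrightarrow> x $ i = 0"
    using s k by (auto simp: x axis_def)
  show "x \<bullet> x = 1"
    unfolding x using s by (auto simp: inner_axis_axis)
qed

lemma D_roots_coordinates:
  assumes "x \<in> D_roots J"
  shows "x $ i \<in> \<int>" "i \<notin> J \<Longrightarrow> x $ i = 0" "\<exists>i\<in>J. x $ i \<noteq> 0"
    "\<exists>m::int. (\<Sum>i\<in>J. x $ i) = 2 * of_int m" "x \<bullet> x = 2"
proof -
  obtain s k t j where x: "x = axis k s + axis j t" and s: "s \<in> {1, -1}" "t \<in> {1, -1}"
    and k: "k \<in> J" "j \<in> J" "k \<noteq> j"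
    using assms by (auto simp: D_roots_def)
  have c: "x $ i = (if i = k then s else if i = j then t else 0)" for i
    using k(3) by (simp add: x axis_def)
  show "x $ i \<in> \<int>" "i \<notin> J \<Longrightarrow> x $ i = 0"
    using s k by (auto simp: c)
  have "(\<Sum>i\<in>J. x $ i) = (\<Sum>i\<in>J. (if i = k then s else 0) + (if i = j then t else 0))"
    using k(3) by (intro sum.cong) (auto simp: c)
  also have "\<dots> = s + t"
    using k by (simp add: sum.distrib)
  finally have "(\<Sum>i\<in>J. x $ i) = s + t" .
  moreover have "s + t \<in> {2 * of_int 1, 2 * of_int 0, 2 * of_int (-1)}"
    using s by auto
  ultimately show "\<exists>m::int. (\<Sum>i\<in>J. x $ i) = 2 * of_int m"
    by (metis (no_types) empty_iff insert_iff)
  have "x $ k \<noteq> 0"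
    using s by (auto simp: c)
  then show "\<exists>i\<in>J. x $ i \<noteq> 0"
    using k(1) by blast
  show "x \<bullet> x = 2"
    unfolding x using s k(3) by (auto simp: inner_add_left inner_add_right inner_axis_axis)
qed

text \<open>Adding an index \<open>k\<close> to \<open>J\<close> adds the \<open>4 * card J\<close> roots with a nonzero coordinate at \<open>k\<close>.\<close>

lemma card_D_roots: "card J * (card J - 1) * 2 \<le> card (D_roots J)"
proof -
  have "finite J"
    by simp
  then show ?thesis
  proof (induction J rule: finite_induct)
    case (insert k J)
    define g where "g = (\<lambda>(s, t, j). axis k s + axis j (t :: real) :: real ^ 'a)"
    let ?X = "{1, -1 :: real} \<times> {1, -1 :: real} \<times> J"
    have sub: "D_roots J \<union> g ` ?X \<subseteq> D_roots (insert k J)"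
    proof (rule Un_least)
      show "D_roots J \<subseteq> D_roots (insert k J)"
        unfolding D_roots_def by (rule image_mono) blast
      show "g ` ?X \<subseteq> D_roots (insert k J)"
      proof
        fix x assume "x \<in> g ` ?X"
        then obtain s t j where "x = axis k s + axis j t" "s \<in> {1, -1}" "t \<in> {1, -1}" "j \<in> J"
          by (auto simp: g_def)
        moreover from this(4) have "k \<noteq> j"
          using insert.hyps(2) by blast
        ultimately show "x \<in> D_roots (insert k J)"
          unfolding D_roots_def by (intro image_eqI[of _ _ "(s, k, t, j)"]) auto
      qed
    qed
    have coord: "g (s, t, j) $ i = (if i = k then s else if i = j then t else 0)"
      if "j \<in> J" for s t j i
      using that insert.hyps(2) by (auto simp: g_def axis_def)
    have inj: "inj_on g ?X"
    proof (rule inj_onI)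
      fix p p' assume p: "p \<in> ?X" "p' \<in> ?X" and "g p = g p'"
      obtain s t j s' t' j' where pp: "p = (s, t, j)" "p' = (s', t', j')"
        by (metis prod_cases3)
      have st: "t \<in> {1, -1}" and j: "j \<in> J" "j' \<in> J" and eq: "g (s, t, j) = g (s', t', j')"
        using p \<open>g p = g p'\<close> unfolding pp by blast+
      have e: "g (s, t, j) $ i = g (s', t', j') $ i" for i
        by (rule arg_cong[OF eq])
      have ne: "j \<noteq> k"
        using j(1) insert.hyps(2) by blast
      have "s = s'"
        using e[of k] unfolding coord[OF j(1)] coord[OF j(2)] by simp
      moreover have "t = (if j = j' then t' else 0)"
        using e[of j] ne unfolding coord[OF j(1)] coord[OF j(2)] by simp
      ultimately show "p = p'"
        using st unfolding pp by (auto split: if_splits)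
    qed
    have "D_roots J \<inter> g ` ?X = {}"
    proof -
      have "x $ k = 0" if "x \<in> D_roots J" for x
        using D_roots_coordinates(2)[OF that insert.hyps(2)] .
      moreover have "x $ k \<noteq> 0" if "x \<in> g ` ?X" for x
        using that by (auto simp: coord)
      ultimately show ?thesis
        by blast
    qed
    then have "card (D_roots J \<union> g ` ?X) = card (D_roots J) + card (g ` ?X)"
      using finite_D_roots insert.hyps(1) by (intro card_Un_disjoint) auto
    also have "card (g ` ?X) = 4 * card J"
      using card_image[OF inj] by (simp add: card_cartesian_product)
    finally have "card (D_roots J) + 4 * card J \<le> card (D_roots (insert k J))"
      using card_mono[OF finite_D_roots sub] by simp
    moreover have "(card J + 1) * card J * 2 = card J * (card J - 1) * 2 + 4 * card J"
      by (cases "card J") simp_all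
    ultimately show ?case
      using insert.IH insert.hyps by simp
  qed simp
qed

text \<open>The upper bound is already known, so a lattice is shown to be extremal by exhibiting sufficiently
  many short vectors.\<close>

lemma N_le2_ge:
  fixes L :: "(real ^ 'n) set"
  assumes L: "integral_lattice L" and A: "A \<subseteq> units L" and B: "B \<subseteq> roots L"
    and card: "f_bound CARD('n) \<le> card A + card B"
  shows "N_le2 L = f_bound CARD('n) + 1"
proof -
  have "card A + card B \<le> card (units L) + card (roots L)"
    using finite_units_roots[OF L] A B by (intro add_mono card_mono)
  then show ?thesis
    using N_le2_le[OF L] N_le2_eq[OF L] card by simp
qed

lemma Ints_inner:
  fixes x y :: "real ^ 'n"
  assumes "\<And>i. x $ i * y $ i \<in> \<int>"
  shows "x \<bullet> y \<in> \<int>"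
  unfolding inner_vec_def by (intro Ints_sum) (simp add: assms)

lemma cubic_lattice:
  assumes "f_bound CARD('n) = 2 * CARD('n)\<^sup>2"
  shows "\<exists>L :: (real ^ 'n) set. integral_lattice L \<and> N_le2 L = f_bound CARD('n) + 1"
proof (intro exI conjI)
  define L where "L = {x :: real ^ 'n. \<forall>i. x $ i \<in> \<int>}"
  show lat: "integral_lattice L"
    by (rule integral_latticeI[of L "\<lambda>_. 1"]) (auto simp: L_def add_group_def intro!: Ints_inner)
  have "axis_units UNIV \<subseteq> units L"
    using axis_units_coordinates(1,3)[of _ UNIV] by (auto simp: units_def L_def)
  moreover have "D_roots UNIV \<subseteq> roots L"
    using D_roots_coordinates(1,5)[of _ UNIV] by (auto simp: roots_def L_def)
  moreover have "f_bound CARD('n) \<le> card (axis_units (UNIV :: 'n set)) + card (D_roots (UNIV :: 'n set))"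
  proof -
    have "2 * CARD('n)\<^sup>2 = 2 * CARD('n) + CARD('n) * (CARD('n) - 1) * 2"
      by (cases "CARD('n)") (simp_all add: power2_eq_square)
    then show ?thesis
      using assms card_axis_units[of "UNIV :: 'n set"] card_D_roots[of "UNIV :: 'n set"] by linarith
  qed
  ultimately show "N_le2 L = f_bound CARD('n) + 1"
    by (rule N_le2_ge[OF lat])
qed

lemma even_subsets_card:
  assumes "finite I" "I \<noteq> {}"
  shows "card {T. T \<subseteq> I \<and> even (card T)} = 2 ^ (card I - 1)"
proof -
  let ?E = "{T. T \<subseteq> I \<and> even (card T)}" and ?O = "{T. T \<subseteq> I \<and> odd (card T)}"
  have "card ?E = card ?O"
    using card_subsupersets_even_odd[of I "{}"] assms by auto
  moreover have "Pow I = ?E \<union> ?O" "?E \<inter> ?O = {}"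
    by auto
  then have "card (Pow I) = card ?E + card ?O"
    using assms(1) by (metis (no_types, lifting) card_Un_disjoint finite_Pow_iff finite_Un)
  moreover have "card (Pow I) = 2 * 2 ^ (card I - 1)"
    using assms by (simp add: card_Pow card_gt_0_iff power_eq_if)
  ultimately show ?thesis
    by simp
qed

text \<open>The group generated by \<open>D\<close> and a glue vector \<open>h\<close> is the union of the two cosets \<open>D\<close> and \<open>h + D\<close>,
  because \<open>h + h\<close> lies in \<open>D\<close>.\<close>

lemma glued_group:
  fixes D :: "'a::real_inner set"
  assumes D: "add_group D" "\<And>x y. x \<in> D \<Longrightarrow> y \<in> D \<Longrightarrow> x \<bullet> y \<in> \<int>"
    and h: "h + h \<in> D" "\<And>x. x \<in> D \<Longrightarrow> h \<bullet> x \<in> \<int>" "h \<bullet> h \<in> \<int>"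
  defines "L \<equiv> D \<union> {x. x - h \<in> D}"
  shows "add_group L" "\<And>x y. x \<in> L \<Longrightarrow> y \<in> L \<Longrightarrow> x \<bullet> y \<in> \<int>" "\<And>x. x \<in> L \<Longrightarrow> x + x \<in> D"
proof -
  note G = add_groupD[OF D(1)]
  show "add_group L"
    unfolding add_group_def
  proof (intro conjI ballI)
    show "0 \<in> L"
      using G(1) by (simp add: L_def)
    fix x y assume "x \<in> L" "y \<in> L"
    then consider "x \<in> D" "y \<in> D" | "x - h \<in> D" "y \<in> D" | "x \<in> D" "y - h \<in> D"
      | "x - h \<in> D" "y - h \<in> D"
      unfolding L_def by blast
    then show "x - y \<in> L"
    proof cases
      case 1
      then show ?thesis
        using G(2) by (simp add: L_def)
    next
      case 2
      then have "(x - h) - y \<in> D"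
        by (rule G(2))
      then show ?thesis
        by (simp add: L_def algebra_simps)
    next
      case 3
      then have "(x - (y - h)) - (h + h) \<in> D"
        using G(2) h(1) by blast
      then show ?thesis
        by (simp add: L_def algebra_simps)
    next
      case 4
      then have "(x - h) - (y - h) \<in> D"
        by (rule G(2))
      then show ?thesis
        by (simp add: L_def)
    qed
  qed
  have decomp: "\<exists>d\<in>D. x = d \<or> x = d + h" if "x \<in> L" for x
    using that unfolding L_def by (metis UnE diff_add_cancel mem_Collect_eq)
  have hD: "d \<bullet> h \<in> \<int>" if "d \<in> D" for d
    using h(2)[OF that] by (simp add: inner_commute)
  show "x \<bullet> y \<in> \<int>" if xy: "x \<in> L" "y \<in> L" for x y
  proof -
    obtain d where d: "d \<in> D" "x = d \<or> x = d + h"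
      using decomp[OF xy(1)] by blast
    obtain e where e: "e \<in> D" "y = e \<or> y = e + h"
      using decomp[OF xy(2)] by blast
    have i: "d \<bullet> e \<in> \<int>" "d \<bullet> h \<in> \<int>" "h \<bullet> e \<in> \<int>" "h \<bullet> h \<in> \<int>"
      using D(2) hD h(2,3) d(1) e(1) by blast+
    show ?thesis
      using d(2) e(2) by (elim disjE) (simp_all add: inner_add_left inner_add_right i)
  qed
  show "x + x \<in> D" if x: "x \<in> L" for x
  proof -
    obtain d where d: "d \<in> D" "x = d \<or> x = d + h"
      using decomp[OF x] by blast
    have "d + d \<in> D" "(d + d) + (h + h) \<in> D"
      using G(4) d(1) h(1) by blast+
    then show ?thesis
      using d(2) by (auto simp: algebra_simps)
  qed
qed

text \<open>The orthogonal sum of the root lattice of type \<open>D\<close> on the coordinates in \<open>I\<close> and of copies of \<open>c\<close> times the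
  integers on the other coordinates. Gluing by a vector with entries \<open>1/2\<close> on \<open>I\<close> and \<open>t\<close> elsewhere
  gives the two exceptional extremal lattices: \<open>card I = 8\<close>, \<open>c = 1\<close>, \<open>t = 0\<close> is \<open>E8\<close> plus a cubic lattice;
  \<open>card I = 6\<close> with one further coordinate, \<open>c = sqrt 2\<close>, \<open>t = sqrt 2 / 2\<close> is \<open>D6\<close> glued to \<open>A1\<close>,
  which is \<open>E7\<close>.\<close>

definition even_sum_lattice :: "real \<Rightarrow> 'n::finite set \<Rightarrow> (real ^ 'n) set" where
  "even_sum_lattice c I = {x. (\<forall>i\<in>I. x $ i \<in> \<int>) \<and> (\<exists>m::int. (\<Sum>i\<in>I. x $ i) = 2 * of_int m)
     \<and> (\<forall>i. i \<notin> I \<longrightarrow> x $ i / c \<in> \<int>)}"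

definition glue :: "real \<Rightarrow> 'n::finite set \<Rightarrow> real ^ 'n" where
  "glue t I = (\<chi> i. if i \<in> I then 1/2 else t)"

definition glued_lattice :: "real \<Rightarrow> real \<Rightarrow> 'n::finite set \<Rightarrow> (real ^ 'n) set" where
  "glued_lattice c t I = even_sum_lattice c I \<union> {x. x - glue t I \<in> even_sum_lattice c I}"

lemma add_group_even_sum_lattice: "add_group (even_sum_lattice c I)"
  unfolding add_group_def
proof (intro conjI ballI)
  show "0 \<in> even_sum_lattice c I"
    by (auto simp: even_sum_lattice_def intro!: exI[of _ 0])
  fix x y assume x: "x \<in> even_sum_lattice c I" and y: "y \<in> even_sum_lattice c I"
  obtain m n :: int where "(\<Sum>i\<in>I. x $ i) = 2 * of_int m" "(\<Sum>i\<in>I. y $ i) = 2 * of_int n"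
    using x y unfolding even_sum_lattice_def by blast
  then have "(\<Sum>i\<in>I. (x - y) $ i) = 2 * of_int (m - n)"
    by (simp add: sum_subtractf)
  then have "\<exists>m::int. (\<Sum>i\<in>I. (x - y) $ i) = 2 * of_int m"
    by blast
  then show "x - y \<in> even_sum_lattice c I"
    using x y by (simp add: even_sum_lattice_def diff_divide_distrib)
qed

lemma sum_if_UNIV:
  fixes f g :: "'n::finite \<Rightarrow> real"
  shows "(\<Sum>i\<in>UNIV. if i \<in> I then f i else g i) = (\<Sum>i\<in>I. f i) + (\<Sum>i\<in>- I. g i)"
  by (simp add: sum.If_cases)

lemma glue_inner_self: "glue t I \<bullet> glue t I = real (card I) / 4 + real (card (- I)) * t\<^sup>2"
proof -
  have "glue t I \<bullet> glue t I = (\<Sum>i\<in>UNIV. if i \<in> I then 1/4 else t\<^sup>2)"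
    unfolding inner_vec_def by (intro sum.cong) (auto simp: glue_def power2_eq_square)
  then show ?thesis
    by (simp add: sum_if_UNIV)
qed

lemma glued_lattice_integral:
  fixes I :: "'n::finite set"
  assumes I: "even (card I)" and c: "c \<noteq> 0" "c\<^sup>2 \<in> \<int>" and t: "c * t \<in> \<int>" "2 * t / c \<in> \<int>"
    and h: "real (card I) / 4 + real (card (- I)) * t\<^sup>2 = 2"
  shows "integral_lattice (glued_lattice c t I)"
proof -
  let ?D = "even_sum_lattice c I" and ?h = "glue t I"
  have D: "x \<bullet> y \<in> \<int>" if x: "x \<in> ?D" and y: "y \<in> ?D" for x y
  proof (rule Ints_inner)
    fix i
    show "x $ i * y $ i \<in> \<int>"
    proof (cases "i \<in> I")
      case True
      then show ?thesis
        using x y by (simp add: even_sum_lattice_def)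
    next
      case False
      then have "x $ i / c \<in> \<int>" "y $ i / c \<in> \<int>"
        using x y by (simp_all add: even_sum_lattice_def)
      then have "c\<^sup>2 * ((x $ i / c) * (y $ i / c)) \<in> \<int>"
        using c(2) by (intro Ints_mult)
      moreover have "c\<^sup>2 * ((x $ i / c) * (y $ i / c)) = x $ i * y $ i"
        using c(1) by (simp add: power2_eq_square)
      ultimately show ?thesis
        by simp
    qed
  qed
  have hx: "?h \<bullet> x \<in> \<int>" if x: "x \<in> ?D" for x
  proof -
    obtain m :: int where m: "(\<Sum>i\<in>I. x $ i) = 2 * of_int m"
      using x unfolding even_sum_lattice_def by blast
    have "?h \<bullet> x = (\<Sum>i\<in>UNIV. if i \<in> I then x $ i / 2 else t * x $ i)"
      unfolding inner_vec_def by (intro sum.cong) (auto simp: glue_def)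
    also have "\<dots> = of_int m + (\<Sum>i\<in>- I. t * x $ i)"
      unfolding sum_if_UNIV by (simp add: m flip: sum_divide_distrib)
    finally have "?h \<bullet> x = of_int m + (\<Sum>i\<in>- I. t * x $ i)" .
    moreover have "t * x $ i \<in> \<int>" if "i \<in> - I" for i
    proof -
      have "x $ i / c \<in> \<int>"
        using x that by (simp add: even_sum_lattice_def)
      then have "(c * t) * (x $ i / c) \<in> \<int>"
        by (rule Ints_mult[OF t(1)])
      then show ?thesis
        using c(1) by simp
    qed
    then have "(\<Sum>i\<in>- I. t * x $ i) \<in> \<int>"
      by (rule Ints_sum)
    ultimately show ?thesis
      by (simp add: Ints_add)
  qed
  obtain k where k: "card I = 2 * k"
    using I by blast
  have "\<exists>m::int. (\<Sum>i\<in>I. (?h + ?h) $ i) = 2 * of_int m"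
    by (rule exI[of _ "int k"]) (simp add: glue_def k)
  then have hh: "?h + ?h \<in> ?D"
    using t(2) by (simp add: even_sum_lattice_def glue_def)
  have hint: "?h \<bullet> ?h \<in> \<int>"
    unfolding glue_inner_self h by simp
  note L = glued_group[OF add_group_even_sum_lattice D hh hx hint, folded glued_lattice_def]
  show ?thesis
  proof (rule integral_latticeI[OF L(1) _ _ L(2)])
    define w where "w i = (if i \<in> I then 1/2 else c/2)" for i
    show "w i \<noteq> 0" for i
      using c(1) by (simp add: w_def)
    fix x i assume x: "x \<in> glued_lattice c t I"
    have "x + x \<in> ?D"
    proof (rule glued_group(3)[of ?D ?h x])
      show "x \<in> ?D \<union> {x. x - ?h \<in> ?D}"
        using x by (simp add: glued_lattice_def)
    qed (use add_group_even_sum_lattice D hh hx hint in blast)+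
    then have "i \<in> I \<Longrightarrow> x $ i + x $ i \<in> \<int>" "i \<notin> I \<Longrightarrow> (x $ i + x $ i) / c \<in> \<int>"
      by (simp_all add: even_sum_lattice_def)
    moreover have "x $ i / w i = (if i \<in> I then x $ i + x $ i else (x $ i + x $ i) / c)"
      by (simp add: w_def)
    ultimately show "x $ i / w i \<in> \<int>"
      by simp
  qed
qed

text \<open>The roots in the glue coset whose entries on \<open>I\<close> are \<open>\<plusminus>1/2\<close> and whose other entries are \<open>t\<close>; the
  set \<open>T\<close> holds the indices of the minus signs.\<close>

definition half_roots :: "real \<Rightarrow> 'n::finite set \<Rightarrow> (real ^ 'n) set" where
  "half_roots t I = (\<lambda>T. glue t I - (\<chi> i. if i \<in> T then 1 else 0)) ` {T. T \<subseteq> I \<and> even (card T)}"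

lemma card_half_roots:
  assumes "I \<noteq> {}"
  shows "card (half_roots t I) = 2 ^ (card I - 1)"
proof -
  have "inj (\<lambda>T. glue t I - (\<chi> i. if i \<in> T then 1 else 0))"
    by (rule injI) (auto simp: vec_eq_iff split: if_splits)
  then have "card (half_roots t I) = card {T. T \<subseteq> I \<and> even (card T)}"
    unfolding half_roots_def by (intro card_image) (rule inj_on_subset, auto)
  then show ?thesis
    using even_subsets_card[of I] assms by simp
qed

lemma half_roots_coordinates:
  assumes "x \<in> half_roots t I"
  shows "i \<in> I \<Longrightarrow> x $ i \<notin> \<int>" "i \<notin> I \<Longrightarrow> x $ i = t" "x - glue t I \<in> even_sum_lattice c I"
    "x \<bullet> x = glue t I \<bullet> glue t I"
proof -
  obtain T where T: "T \<subseteq> I" "even (card T)" and x: "x = glue t I - (\<chi> i. if i \<in> T then 1 else 0)"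
    using assms by (auto simp: half_roots_def)
  show "x $ i \<notin> \<int>" if "i \<in> I"
  proof -
    have "x $ i = 1/2 \<or> x $ i = -1/2"
      using that by (auto simp: x glue_def)
    then have "x $ i - 1/2 = of_int 0 \<or> x $ i - 1/2 = of_int (-1)"
      by auto
    then show ?thesis
      by (metis Ints_of_int half_not_Ints)
  qed
  show "x $ i = t" if "i \<notin> I"
    using that T(1) by (auto simp: x glue_def)
  obtain k where k: "card T = 2 * k"
    using T(2) by blast
  have "(\<Sum>i\<in>I. (x - glue t I) $ i) = (\<Sum>i\<in>I. if i \<in> T then -1 else 0)"
    by (intro sum.cong) (auto simp: x)
  also have "\<dots> = - real (card T)"
    using T(1) by (simp add: sum.If_cases Int_absorb1)
  also have "\<dots> = 2 * of_int (- int k)"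
    by (simp add: k)
  finally have "\<exists>m::int. (\<Sum>i\<in>I. (x - glue t I) $ i) = 2 * of_int m"
    by blast
  moreover have "(x - glue t I) $ i = (if i \<in> T then -1 else 0)" for i
    by (simp add: x)
  then have "(x - glue t I) $ i \<in> \<int>" "i \<notin> I \<Longrightarrow> (x - glue t I) $ i = 0" for i
    using T(1) by auto
  ultimately show "x - glue t I \<in> even_sum_lattice c I"
    by (simp add: even_sum_lattice_def)
  show "x \<bullet> x = glue t I \<bullet> glue t I"
    unfolding inner_vec_def using T(1) by (intro sum.cong) (auto simp: x glue_def)
qed

lemma D_roots_subset_glued:
  shows "D_roots I \<subseteq> roots (glued_lattice c t I)"
proof
  fix x assume "x \<in> D_roots I"
  note x = D_roots_coordinates[OF this]
  have "x \<in> even_sum_lattice c I"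
    using x(1,2,4) by (simp add: even_sum_lattice_def)
  then show "x \<in> roots (glued_lattice c t I)"
    using x(5) by (simp add: roots_def glued_lattice_def)
qed

lemma half_roots_subset_glued:
  assumes "glue t I \<bullet> glue t I = 2"
  shows "half_roots t I \<subseteq> roots (glued_lattice c t I)"
proof
  fix x assume "x \<in> half_roots t I"
  note x = half_roots_coordinates(3,4)[OF this]
  show "x \<in> roots (glued_lattice c t I)"
    using x assms by (simp add: roots_def glued_lattice_def)
qed

text \<open>On eight coordinates, \<open>E8\<close> has the \<open>112\<close> roots of \<open>D8\<close> and \<open>128\<close> roots in the glue coset. The other
  \<open>k\<close> coordinates carry a cubic lattice with \<open>2 * k\<close> unit vectors and \<open>2 * k * (k - 1)\<close> roots.\<close>

lemma E8_plus_cubic_lattice: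
  assumes n: "8 \<le> CARD('n::finite)" "CARD('n) \<le> 11"
  shows "\<exists>L :: (real ^ 'n) set. integral_lattice L \<and> N_le2 L = f_bound CARD('n) + 1"
proof -
  obtain I :: "'n set" where I: "card I = 8"
    using obtain_subset_with_card_n[OF n(1)] by blast
  define k where "k = CARD('n) - 8"
  have J: "card (- I) = k"
    using I by (simp add: k_def Compl_eq_Diff_UNIV card_Diff_subset)
  have Ine: "I \<noteq> {}"
    using I by auto
  define L where "L = glued_lattice 1 0 I"
  have lat: "integral_lattice L"
    unfolding L_def by (rule glued_lattice_integral) (simp_all add: I)
  have int: "x \<in> L" if "\<And>i. x $ i \<in> \<int>" "\<And>i. i \<in> I \<Longrightarrow> x $ i = 0" for x
  proof -
    have "(\<Sum>i\<in>I. x $ i) = 2 * of_int 0"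
      using that(2) by simp
    then have "\<exists>m::int. (\<Sum>i\<in>I. x $ i) = 2 * of_int m"
      by blast
    then show ?thesis
      using that(1) by (simp add: L_def glued_lattice_def even_sum_lattice_def)
  qed
  have units: "axis_units (- I) \<subseteq> units L"
  proof
    fix x assume "x \<in> axis_units (- I)"
    note x = axis_units_coordinates[OF this]
    show "x \<in> units L"
      using int[of x] x by (simp add: units_def)
  qed
  have "D_roots (- I) \<subseteq> roots L"
  proof
    fix x assume "x \<in> D_roots (- I)"
    note x = D_roots_coordinates[OF this]
    show "x \<in> roots L"
      using int[of x] x(1,2,5) by (simp add: roots_def)
  qed
  moreover have "D_roots I \<subseteq> roots L"
    unfolding L_def by (rule D_roots_subset_glued)
  moreover have "half_roots 0 I \<subseteq> roots L"
    unfolding L_def by (rule half_roots_subset_glued) (simp add: glue_inner_self I)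
  ultimately have roots: "half_roots 0 I \<union> (D_roots I \<union> D_roots (- I)) \<subseteq> roots L"
    by blast
  have fin: "finite (half_roots 0 I)"
    by (simp add: half_roots_def)
  obtain i where i: "i \<in> I"
    using Ine by blast
  have "D_roots I \<inter> D_roots (- I) = {}"
  proof -
    have "\<exists>i\<in>I. x $ i \<noteq> 0" if "x \<in> D_roots I" for x
      using D_roots_coordinates(3)[OF that] .
    moreover have "x $ i = 0" if "x \<in> D_roots (- I)" "i \<in> I" for x i
      using D_roots_coordinates(2)[OF that(1), of i] that(2) by simp
    ultimately show ?thesis
      by blast
  qed
  then have "card (D_roots I \<union> D_roots (- I)) = card (D_roots I) + card (D_roots (- I))"
    by (rule card_Un_disjoint[OF finite_D_roots finite_D_roots])
  moreover have "half_roots 0 I \<inter> (D_roots I \<union> D_roots (- I)) = {}"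
    using half_roots_coordinates(1)[OF _ i] D_roots_coordinates(1) by blast
  then have "card (half_roots 0 I \<union> (D_roots I \<union> D_roots (- I)))
      = card (half_roots 0 I) + card (D_roots I \<union> D_roots (- I))"
    using fin finite_D_roots by (intro card_Un_disjoint) auto
  moreover have "card (half_roots 0 I) = 128"
    using card_half_roots[OF Ine] I by simp
  moreover have "112 \<le> card (D_roots I)"
    using card_D_roots[of I] I by simp
  moreover have "k * (k - 1) * 2 \<le> card (D_roots (- I))"
    using card_D_roots[of "- I"] J by simp
  moreover have "card (axis_units (- I)) = 2 * k"
    using card_axis_units[of "- I"] J by simp
  moreover have "2 * k\<^sup>2 = 2 * k + k * (k - 1) * 2"
    by (cases k) (simp_all add: power2_eq_square)
  moreover have "f_bound CARD('n) = 240 + 2 * k\<^sup>2"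
    using n by (simp add: f_bound_def k_def)
  ultimately have "f_bound CARD('n)
      \<le> card (axis_units (- I)) + card (half_roots 0 I \<union> (D_roots I \<union> D_roots (- I)))"
    by linarith
  then show ?thesis
    using N_le2_ge[OF lat units roots] lat by blast
qed

text \<open>The \<open>126\<close> roots of \<open>E7\<close> are the \<open>60\<close> roots of \<open>D6\<close>, the \<open>2\<close> roots of \<open>A1\<close> and the \<open>64\<close> roots
  in the glue coset. Negation exchanges the \<open>32\<close> of these whose entry outside \<open>I\<close> is \<open>t\<close> with the \<open>32\<close>
  whose entry there is \<open>- t\<close>.\<close>

lemma E7_lattice:
  assumes n: "CARD('n::finite) = 7"
  shows "\<exists>L :: (real ^ 'n) set. integral_lattice L \<and> N_le2 L = f_bound CARD('n) + 1"
proof -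
  obtain I :: "'n set" where I: "card I = 6"
    using obtain_subset_with_card_n[of 6 "UNIV :: 'n set"] n by auto
  have J: "card (- I) = 1"
    using I n by (simp add: Compl_eq_Diff_UNIV card_Diff_subset)
  then obtain p where p: "- I = {p}"
    by (rule card_1_singletonE)
  have pI: "p \<notin> I"
    using p by blast
  have Ine: "I \<noteq> {}"
    using I by auto
  define t where "t = sqrt 2 / 2"
  have t: "t > 0" "t\<^sup>2 = 1/2" "sqrt 2 * t = 1" "2 * t / sqrt 2 = 1"
    by (simp_all add: t_def power_divide)
  define L where "L = glued_lattice (sqrt 2) t I"
  have lat: "integral_lattice L"
    unfolding L_def by (rule glued_lattice_integral) (simp_all only: t I J, simp_all)
  have hh: "glue t I \<bullet> glue t I = 2"
    by (simp add: glue_inner_self I J t)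
  define A where "A = axis p ` {sqrt 2, - sqrt 2}"
  have half: "half_roots t I \<subseteq> roots L"
    unfolding L_def by (rule half_roots_subset_glued[OF hh])
  have "uminus ` half_roots t I \<subseteq> roots L"
    using half integral_groupD(5)[OF integral_lattice_imp_integral_group[OF lat]]
    by (auto simp: roots_def)
  moreover have "D_roots I \<subseteq> roots L"
    unfolding L_def by (rule D_roots_subset_glued)
  moreover have "A \<subseteq> roots L"
  proof
    fix x assume "x \<in> A"
    then obtain s where s: "s = sqrt 2 \<or> s = - sqrt 2" "x = axis p s"
      by (auto simp: A_def)
    have x: "x $ i = (if i = p then s else 0)" for i
      by (simp add: s(2) axis_def)
    have "i \<in> I \<Longrightarrow> x $ i = 0" for i
      using pI by (auto simp: x)
    then have "(\<Sum>i\<in>I. x $ i) = 2 * of_int 0"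
      by simp
    then have "\<exists>m::int. (\<Sum>i\<in>I. x $ i) = 2 * of_int m"
      by blast
    moreover have "x $ i / sqrt 2 \<in> \<int>" for i
      using s(1) by (auto simp: x)
    ultimately have "x \<in> L"
      using pI by (simp add: L_def glued_lattice_def even_sum_lattice_def)
        (simp add: x)
    moreover have "x \<bullet> x = 2"
      using s by (auto simp: inner_axis_axis)
    ultimately show "x \<in> roots L"
      by (simp add: roots_def)
  qed
  ultimately have roots: "half_roots t I \<union> (uminus ` half_roots t I \<union> (D_roots I \<union> A)) \<subseteq> roots L"
    using half by blast
  have fin: "finite (half_roots t I)" "finite A"
    by (simp_all add: half_roots_def A_def)
  \<comment> \<open>The four sets are told apart by the coordinate \<open>p\<close>.\<close>
  have "half_roots t I \<subseteq> {x. x $ p = t}"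
    using half_roots_coordinates(2)[OF _ pI] by blast
  moreover have "uminus ` half_roots t I \<subseteq> {x. x $ p = - t}"
    using half_roots_coordinates(2)[OF _ pI] by auto
  moreover have "D_roots I \<subseteq> {x. x $ p = 0}"
    using D_roots_coordinates(2)[OF _ pI] by blast
  moreover have "A \<subseteq> {x. x $ p = 2 * t \<or> x $ p = - (2 * t)}"
    by (auto simp: A_def t_def axis_def)
  moreover have "{x. x $ p = 0} \<inter> {x. x $ p = 2 * t \<or> x $ p = - (2 * t)} = ({} :: (real ^ 'n) set)"
    "{x. x $ p = - t} \<inter> ({x. x $ p = 0} \<union> {x. x $ p = 2 * t \<or> x $ p = - (2 * t)}) = ({} :: (real ^ 'n) set)"
    "{x. x $ p = t} \<inter> ({x. x $ p = - t} \<union> ({x. x $ p = 0} \<union> {x. x $ p = 2 * t \<or> x $ p = - (2 * t)}))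
      = ({} :: (real ^ 'n) set)"
    using t(1) by auto
  ultimately have disj: "D_roots I \<inter> A = {}" "uminus ` half_roots t I \<inter> (D_roots I \<union> A) = {}"
    "half_roots t I \<inter> (uminus ` half_roots t I \<union> (D_roots I \<union> A)) = {}"
    by (blast, blast, blast)
  from disj(1) have "card (D_roots I \<union> A) = card (D_roots I) + card A"
    by (rule card_Un_disjoint[OF finite_D_roots fin(2)])
  moreover from disj(2) have "card (uminus ` half_roots t I \<union> (D_roots I \<union> A))
      = card (uminus ` half_roots t I) + card (D_roots I \<union> A)"
    using fin finite_D_roots by (intro card_Un_disjoint) auto
  moreover from disj(3) have "card (half_roots t I \<union> (uminus ` half_roots t I \<union> (D_roots I \<union> A)))
      = card (half_roots t I) + card (uminus ` half_roots t I \<union> (D_roots I \<union> A))"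
    using fin finite_D_roots by (intro card_Un_disjoint) auto
  moreover have "card (half_roots t I) = 32"
    using card_half_roots[OF Ine] I by simp
  moreover have "card (uminus ` half_roots t I) = card (half_roots t I)"
    by (intro card_image) simp
  moreover have "60 \<le> card (D_roots I)"
    using card_D_roots[of I] I by simp
  moreover have "card A = 2"
    unfolding A_def by (subst card_image) (auto simp: inj_on_def axis_eq_axis card_insert_if)
  ultimately have "f_bound CARD('n)
      \<le> card ({} :: (real ^ 'n) set) + card (half_roots t I \<union> (uminus ` half_roots t I \<union> (D_roots I \<union> A)))"
    using n by (simp add: f_bound_def)
  then show ?thesis
    using N_le2_ge[OF lat empty_subsetI roots] lat by blast
qed

theorem theorem4p1:
  shows "(\<forall>L :: (real ^ 'n) set. integral_lattice L \<longrightarrow> N_le2 L \<le> f_bound CARD('n) + 1) \<and>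
         (\<exists>L :: (real ^ 'n) set. integral_lattice L \<and> N_le2 L = f_bound CARD('n) + 1)"
proof
  show "\<forall>L :: (real ^ 'n) set. integral_lattice L \<longrightarrow> N_le2 L \<le> f_bound CARD('n) + 1"
    using N_le2_le by blast
  consider "CARD('n) = 7" | "8 \<le> CARD('n)" "CARD('n) \<le> 11"
    | "CARD('n) \<noteq> 7" "\<not> (8 \<le> CARD('n) \<and> CARD('n) \<le> 11)"
    by blast
  then show "\<exists>L :: (real ^ 'n) set. integral_lattice L \<and> N_le2 L = f_bound CARD('n) + 1"
  proof cases
    case 1
    then show ?thesis
      by (rule E7_lattice)
  next
    case 2
    then show ?thesis
      by (rule E8_plus_cubic_lattice)
  next
    case 3
    then have "f_bound CARD('n) = 2 * CARD('n)\<^sup>2"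
      by (auto simp: f_bound_def)
    then show ?thesis
      by (rule cubic_lattice)
  qed
qed

end
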